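(* Let $d\ge1$, $\delta>1$ and $\gamma\in(0,1)$ with $\gamma>\frac{\delta}{\delta+1}$. Consider the mobile geometric scale-free random graph $(\mathcal G_t)_{t\ge0}$ on $\mathbb R^d$ whose connection probabilities satisfy Assumption A (see context) with parameters $\gamma,\delta$. Then there exists a constant $c>0$ such that the percolation time $T_{\mathrm{perc}}$ satisfies $$\mathbb P(T_{\mathrm{perc}}>t)\le \exp\{-c\,t^{1/c}\}$$ for any vertex intensity $\lambda>0$ and any $t>0$ sufficiently large.
   Context: Vertices. $\mathcal X_0$ is a Poisson point process of intensity $\lambda$ on $\mathbb R^d\times(0,1)$, to which one adds a vertex $\mathbf 0=(0,U_0)$ at the origin, where $U_0$ is uniform on $(0,1)$ and independent of everything else (Palm version). A vertex is written $\mathbf x=(x,u)$, with location $x$ and mark $u$. Each vertex $\mathbf x=(x,u)$ performs an independent standard Brownian motion $(\pi_{\mathbf x}(t))_{t\ge0}$ on $\mathbb R^d$, keeping its mark: $\mathbf x_t=(x+\pi_{\mathbf x}(t),u)$ and $\mathcal X_t=\{\mathbf x_t:\mathbf x\in\mathcal X_0\}$. The vertex started at the origin is called the origin vertex and is still denoted $\mathbf 0$ at later times. Connection probabilities (Assumption A). There is a symmetric measurable function $p$ giving, for two vertices $\mathbf x=(x,u)$, $\mathbf y=(y,v)$, the probability $p(\mathbf x,\mathbf y)=\mathbb P_{\mathbf x,\mathbf y}(\mathbf x\sim\mathbf y)$ that they are joined by an edge in the static graph; given the vertices, edges of the static graph are drawn independently with these probabilities. There exist $\alpha,\kappa_1>0$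 such that for all $\mathbf x=(x,u),\mathbf y=(y,v)$ $$p(\mathbf x,\mathbf y)\ \ge\ \alpha\Big(1\wedge \kappa_1\,(u\wedge v)^{-\delta\gamma}|x-y|^{-\delta d}\Big).$$ Moreover the expected degree $\mathbb E_{\mathbf x}|\{\mathbf y\in\mathcal X:\mathbf y\sim\mathbf x\}|$ of a vertex $\mathbf x$ in the static graph is finite. Dynamic graph. To each unordered pair of vertices $\mathbf x,\mathbf y$ of $\mathcal X_0$ is attached a sequence $(U^m_{\mathbf x,\mathbf y})_{m\in\mathbb N_0}$ of independent uniform $(0,1)$ random variables, independent over pairs and of the vertices and their motion. In the graph $\mathcal G_t$ on vertex set $\mathcal X_t$ there is an edge between $\mathbf x_t$ and $\mathbf y_t$ (written $\mathbf x\sim\mathbf y$ at time $t$) if and only if $U^{m}_{\mathbf x,\mathbf y}<p(\mathbf x_t,\mathbf y_t)$, where $m=\lfloor t\rfloor$. Percolation time. $\mathcal C_\infty^t$ denotes the infinite connected component of $\mathcal G_t$; it is known that for $\gamma>\frac{\delta}{\delta+1}$ it exists almost surely and is unique, for every $\lambda>0$. The percolation time is $$T_{\mathrm{perc}}:=\inf\{t\ge0:\ \exists\,\mathbf x\in\mathcal C_\infty^t\text{ such that }\mathbf x\sim\mathbf 0\text{ at time }t\},$$ i.e. the first time the origin vertex $\mathbf 0$ belongs to the infinite connected component of $\mathcal G_t$. *)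

theory Defs
  imports "HOL-Probability.Probability"
begin

section \<open>Point processes, Brownian motion and uniform variables\<close>

context prob_space
begin

text \<open>
  A Poisson point process with diffuse \<open>\<sigma>\<close>-finite intensity measure \<open>\<nu>\<close> of infinite total mass,
  given by a measurable enumeration \<open>P 0, P 1, \<dots>\<close> of its points. The \<open>card\<close> of an infinite set
  is 0, hence the separate finiteness clause. The mass function is written out because the
  library's \<open>poisson_pmf\<close> excludes rate 0.
\<close>
definition poisson_process :: "'b measure \<Rightarrow> (nat \<Rightarrow> 'a \<Rightarrow> 'b) \<Rightarrow> bool" where
  "poisson_process \<nu> P \<longleftrightarrow>
     (\<forall>i. random_variable \<nu> (P i)) \<and>
     (\<forall>A\<in>sets \<nu>. emeasure \<nu> A < \<infinity> \<longrightarrow>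
        (AE \<omega> in M. finite {i. P i \<omega> \<in> A}) \<and>
        (\<forall>k. prob {\<omega> \<in> space M. card {i. P i \<omega> \<in> A} = k}
               = measure \<nu> A ^ k / fact k * exp (- measure \<nu> A))) \<and>
     (\<forall>(J :: nat set) A. finite J \<longrightarrow> disjoint_family_on A J \<longrightarrow>
        (\<forall>j\<in>J. A j \<in> sets \<nu> \<and> emeasure \<nu> (A j) < \<infinity>) \<longrightarrow>
        indep_vars (\<lambda>_. count_space UNIV) (\<lambda>j \<omega>. card {i. P i \<omega> \<in> A j}) J)"

definition uniform01 :: "('a \<Rightarrow> real) \<Rightarrow> bool" where
  "uniform01 Y \<longleftrightarrow>
     random_variable borel Y \<and> distr M borel Y = uniform_measure lborel {0<..<1}"

text \<open>\<open>B t\<close> is the position at time \<open>t \<ge> 0\<close>; values at negative times are irrelevant.\<close>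
definition standard_brownian_motion :: "(real \<Rightarrow> 'a \<Rightarrow> 'b::euclidean_space) \<Rightarrow> bool" where
  "standard_brownian_motion B \<longleftrightarrow>
     (\<forall>t\<ge>0. random_variable borel (B t)) \<and>
     (AE \<omega> in M. B 0 \<omega> = 0 \<and> continuous_on {0..} (\<lambda>t. B t \<omega>)) \<and>
     (\<forall>s t. 0 \<le> s \<longrightarrow> s < t \<longrightarrow>
        distributed M lborel (\<lambda>\<omega>. B t \<omega> - B s \<omega>)
          (\<lambda>x. ennreal (\<Prod>b\<in>Basis. normal_density 0 (sqrt (t - s)) (x \<bullet> b)))) \<and>
     (\<forall>(n :: nat) \<tau>. 0 \<le> \<tau> 0 \<longrightarrow> (\<forall>k<n. \<tau> k < \<tau> (Suc k)) \<longrightarrow>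
        indep_vars (\<lambda>_. borel) (\<lambda>k \<omega>. B (\<tau> (Suc k)) \<omega> - B (\<tau> k) \<omega>) {..<n})"

definition generated_events :: "'b measure \<Rightarrow> ('a \<Rightarrow> 'b) \<Rightarrow> 'a set set" where
  "generated_events N Y = sets (vimage_algebra (space M) Y N)"

end


section \<open>Geometric graphs on enumerated vertices\<close>

definition vertex_space :: "('v::euclidean_space \<times> real) set" where
  "vertex_space = UNIV \<times> {0<..<1}"

definition vertex_intensity :: "real \<Rightarrow> ('v::euclidean_space \<times> real) measure" where
  "vertex_intensity lam = scale_measure (ennreal lam) (restrict_space lborel vertex_space)"

text \<open>
  Vertices are represented by their indices: \<open>z i\<close> is the current location and mark of vertex
  \<open>i\<close>, and the variable of the unordered pair \<open>{i, j}\<close> is stored at \<open>W (min i j) (max i j)\<close>.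
\<close>
definition adjacent ::
  "('v \<Rightarrow> 'v \<Rightarrow> real) \<Rightarrow> (nat \<Rightarrow> 'v) \<Rightarrow> (nat \<Rightarrow> nat \<Rightarrow> real) \<Rightarrow> nat \<Rightarrow> nat \<Rightarrow> bool" where
  "adjacent p z W i j \<longleftrightarrow> i \<noteq> j \<and> W (min i j) (max i j) < p (z i) (z j)"

definition components :: "(nat \<Rightarrow> nat \<Rightarrow> bool) \<Rightarrow> nat set set" where
  "components adj = UNIV // {(i, j). adj\<^sup>*\<^sup>* i j}"

text \<open>
  When there is exactly one infinite component, this set is that component; when there is
  none it is empty.
\<close>
definition infinite_component :: "(nat \<Rightarrow> nat \<Rightarrow> bool) \<Rightarrow> nat set" where
  "infinite_component adj = \<Union>{C \<in> components adj. infinite C}"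


section \<open>The static graph and the connection probabilities\<close>

locale static_graph = prob_space M
  for M :: "'w measure"
    and lam :: real
    and P :: "nat \<Rightarrow> 'w \<Rightarrow> 'v::euclidean_space \<times> real"
    and W :: "nat \<Rightarrow> nat \<Rightarrow> 'w \<Rightarrow> real" +
  assumes intensity_pos: "lam > 0"
    and points: "poisson_process (vertex_intensity lam) P"
    and edge_uniform: "\<And>i j. i < j \<Longrightarrow> uniform01 (W i j)"
    and independent: "indep_sets
      (\<lambda>s. case s of
          None \<Rightarrow> generated_events (PiM UNIV (\<lambda>_. borel)) (\<lambda>\<omega> i. P i \<omega>)
        | Some (i, j) \<Rightarrow> generated_events borel (W i j))
      (insert None (Some ` {(i, j). i < j}))"

text \<open>
  The expected degree of a vertex \<open>x\<close> added to the Poisson process; \<open>x\<close> gets index 0 and the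
  Poisson points the indices \<open>Suc i\<close>.
\<close>
definition expected_degree ::
  "'w measure \<Rightarrow> ('v \<Rightarrow> 'v \<Rightarrow> real) \<Rightarrow> (nat \<Rightarrow> 'w \<Rightarrow> 'v) \<Rightarrow> (nat \<Rightarrow> nat \<Rightarrow> 'w \<Rightarrow> real)
     \<Rightarrow> 'v \<Rightarrow> ennreal" where
  "expected_degree M p P W x =
     (\<integral>\<^sup>+ \<omega>. emeasure (count_space UNIV)
        {j. adjacent p (case_nat x (\<lambda>i. P i \<omega>)) (\<lambda>i j. W i j \<omega>) 0 j} \<partial>M)"

text \<open>
  For equal locations the factor \<open>0 powr (- (\<delta> * d))\<close> has to be read as infinity, whereas the
  library sets it to 0; hence the case distinction.
\<close>
definition connection_lower_bound ::
  "real \<Rightarrow> real \<Rightarrow> real \<Rightarrow> real \<Rightarrow> 'v::euclidean_space \<times> real \<Rightarrow> 'v \<times> real \<Rightarrow> real" where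
  "connection_lower_bound \<alpha> \<kappa> \<gamma> \<delta> x y =
     (if fst x = fst y then \<alpha>
      else \<alpha> * min 1 (\<kappa> * min (snd x) (snd y) powr (- (\<delta> * \<gamma>))
                       * norm (fst x - fst y) powr (- (\<delta> * real DIM('v)))))"


section \<open>The mobile graph\<close>

datatype source = Origin_Mark | Points | Motion nat | Pair nat nat nat

text \<open>
  \<open>U0\<close> is the mark of the origin vertex (index 0), \<open>P i\<close> the initial state of vertex \<open>Suc i\<close>,
  \<open>B i\<close> the motion of vertex \<open>i\<close>, and \<open>E i j m\<close> for \<open>i < j\<close> the \<open>m\<close>-th variable of the pair
  \<open>{i, j}\<close>.
\<close>
locale mobile_graph = prob_space M
  for M :: "'w measure"
    and lam :: real
    and U0 :: "'w \<Rightarrow> real"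
    and P :: "nat \<Rightarrow> 'w \<Rightarrow> 'v::euclidean_space \<times> real"
    and B :: "nat \<Rightarrow> real \<Rightarrow> 'w \<Rightarrow> 'v"
    and E :: "nat \<Rightarrow> nat \<Rightarrow> nat \<Rightarrow> 'w \<Rightarrow> real" +
  assumes intensity_pos: "lam > 0"
    and origin_mark_uniform: "uniform01 U0"
    and points: "poisson_process (vertex_intensity lam) P"
    and motion: "\<And>i. standard_brownian_motion (B i)"
    and edge_uniform: "\<And>i j m. i < j \<Longrightarrow> uniform01 (E i j m)"
    and independent: "indep_sets
      (\<lambda>s. case s of
          Origin_Mark \<Rightarrow> generated_events borel U0
        | Points \<Rightarrow> generated_events (PiM UNIV (\<lambda>_. borel)) (\<lambda>\<omega> i. P i \<omega>)
        | Motion i \<Rightarrow> generated_events (PiM {0..} (\<lambda>_. borel)) (\<lambda>\<omega>. \<lambda>t\<in>{0..}. B i t \<omega>)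
        | Pair i j m \<Rightarrow> generated_events borel (E i j m))
      ({Origin_Mark, Points} \<union> range Motion \<union> {Pair i j m | i j m. i < j})"

definition vertex_at ::
  "('w \<Rightarrow> real) \<Rightarrow> (nat \<Rightarrow> 'w \<Rightarrow> 'v::euclidean_space \<times> real) \<Rightarrow> (nat \<Rightarrow> real \<Rightarrow> 'w \<Rightarrow> 'v)
     \<Rightarrow> real \<Rightarrow> 'w \<Rightarrow> nat \<Rightarrow> 'v \<times> real" where
  "vertex_at U0 P B t \<omega> i =
     (let (x, u) = case_nat (0, U0 \<omega>) (\<lambda>i. P i \<omega>) i in (x + B i t \<omega>, u))"

definition mobile_adjacent ::
  "('v::euclidean_space \<times> real \<Rightarrow> 'v \<times> real \<Rightarrow> real) \<Rightarrow> ('w \<Rightarrow> real)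
     \<Rightarrow> (nat \<Rightarrow> 'w \<Rightarrow> 'v \<times> real) \<Rightarrow> (nat \<Rightarrow> real \<Rightarrow> 'w \<Rightarrow> 'v) \<Rightarrow> (nat \<Rightarrow> nat \<Rightarrow> nat \<Rightarrow> 'w \<Rightarrow> real)
     \<Rightarrow> real \<Rightarrow> 'w \<Rightarrow> nat \<Rightarrow> nat \<Rightarrow> bool" where
  "mobile_adjacent p U0 P B E t \<omega> =
     adjacent p (vertex_at U0 P B t \<omega>) (\<lambda>i j. E i j (nat \<lfloor>t\<rfloor>) \<omega>)"

text \<open>The value is infinity if the origin vertex is never joined to the infinite component.\<close>
definition percolation_time ::
  "('v::euclidean_space \<times> real \<Rightarrow> 'v \<times> real \<Rightarrow> real) \<Rightarrow> ('w \<Rightarrow> real)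
     \<Rightarrow> (nat \<Rightarrow> 'w \<Rightarrow> 'v \<times> real) \<Rightarrow> (nat \<Rightarrow> real \<Rightarrow> 'w \<Rightarrow> 'v) \<Rightarrow> (nat \<Rightarrow> nat \<Rightarrow> nat \<Rightarrow> 'w \<Rightarrow> real)
     \<Rightarrow> 'w \<Rightarrow> ereal" where
  "percolation_time p U0 P B E \<omega> =
     Inf (ereal ` {t. 0 \<le> t \<and>
       (\<exists>i \<in> infinite_component (mobile_adjacent p U0 P B E t \<omega>).
          mobile_adjacent p U0 P B E t \<omega> i 0)})"

text \<open>
  The percolation time is an infimum over uncountably many times and the connection function
  is merely measurable, so the events in question need only be measurable with respect to the
  completion of the underlying measure. Tail probabilities are therefore to be stated with
  \<open>outer_measure_of\<close>, which agrees with the completed measure wherever the latter is defined;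
  \<open>measure M\<close> would silently give 0 for a set outside \<open>sets M\<close>.
\<close>

end

theory Submission
  imports Defs "HOL-Real_Asymp.Real_Asymp"
begin

text \<open>
  Only integer times are used. Seen from the origin vertex, the moved vertices form a Poisson
  process at each fixed time, so the Laplace functional of that process bounds all probabilities
  that concern the vertices.

  At scale \<open>z\<close> call a vertex with mark below \<open>1 / z\<close> in a cube of side \<open>2 * z powr ((1 + \<eta>) / d)\<close>
  around the origin vertex a star. Such a cube contains a star unless an event of probability
  at most \<open>exp (- lam * z powr \<eta>)\<close> occurs. Around the first star of scale \<open>z\<close> there are of order
  \<open>z powr \<gamma>\<close> connectors (vertices with mark above \<open>1/2\<close>) joined to it with probability
  of order one, and each is joined to the first star of scale \<open>2 * z\<close> with probability of order
  \<open>z powr (- e)\<close>, \<open>e = \<delta> * (1 + \<eta> - \<gamma>)\<close>. As \<open>\<gamma> > \<delta> / (\<delta> + 1)\<close>, one can choose \<open>\<eta> > 0\<close> with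
  \<open>e < \<gamma>\<close>, so consecutive stars fail to be linked with stretched exponentially small
  probability. The chain of stars at the scales \<open>t * 2 ^ n\<close> is infinite since its marks tend to \<open>0\<close>.

  Hence, up to a stretched exponentially small probability, at all integer times up to \<open>t\<close> the
  first star of scale \<open>t\<close> lies in an infinite component. The origin vertex is joined to it with
  probability of order \<open>t powr (- e)\<close>, independently at different integer times given the
  vertices, so it misses all of them with probability at most \<open>exp (- const * t powr (1 - e))\<close>.
\<close>

section \<open>The Laplace functional of a Poisson process\<close>

context prob_space
begin

lemma poisson_process_measurable:
  "poisson_process \<nu> P \<Longrightarrow> P i \<in> measurable M \<nu>"
  by (simp add: poisson_process_def)

text \<open>The probability generating function of a Poisson variable: split over the values of
  \<open>N\<close> and sum the exponential series. The mass formula also covers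
  \<open>\<mu> = 0\<close>.\<close>

lemma nn_integral_power_poisson:
  fixes N :: "'a \<Rightarrow> nat"
  assumes N[measurable]: "N \<in> measurable M (count_space UNIV)"
    and poisson: "\<And>k. prob {\<omega> \<in> space M. N \<omega> = k} = \<mu> ^ k / fact k * exp (- \<mu>)"
    and "0 \<le> \<mu>" "0 \<le> x"
  shows "(\<integral>\<^sup>+\<omega>. ennreal (x ^ N \<omega>) \<partial>M) = ennreal (exp (- ((1 - x) * \<mu>)))"
proof -
  have "(\<integral>\<^sup>+\<omega>. ennreal (x ^ N \<omega>) \<partial>M)
      = (\<integral>\<^sup>+\<omega>. (\<Sum>k. ennreal (x ^ k) * indicator {\<omega> \<in> space M. N \<omega> = k} \<omega>) \<partial>M)"
  proof (rule nn_integral_cong)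
    fix \<omega> assume "\<omega> \<in> space M"
    then have "(\<Sum>k. ennreal (x ^ k) * indicator {\<omega> \<in> space M. N \<omega> = k} \<omega>)
        = (\<Sum>k\<in>{N \<omega>}. ennreal (x ^ k) * indicator {\<omega> \<in> space M. N \<omega> = k} \<omega>)"
      by (intro suminf_finite) auto
    with \<open>\<omega> \<in> space M\<close> show "ennreal (x ^ N \<omega>)
        = (\<Sum>k. ennreal (x ^ k) * indicator {\<omega> \<in> space M. N \<omega> = k} \<omega>)" by simp
  qed
  also have "\<dots> = (\<Sum>k. ennreal (x ^ k) * emeasure M {\<omega> \<in> space M. N \<omega> = k})"
    by (subst nn_integral_suminf) (auto intro!: suminf_cong nn_integral_cmult_indicator)
  also have "\<dots> = (\<Sum>k. ennreal ((x * \<mu>) ^ k /\<^sub>R fact k * exp (- \<mu>)))"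
    using assms by (intro suminf_cong)
      (simp add: emeasure_eq_measure ennreal_mult' [symmetric] power_mult_distrib field_simps)
  also have "\<dots> = ennreal (exp (x * \<mu>) * exp (- \<mu>))"
    using assms by (intro suminf_ennreal_eq sums_mult2 exp_converges) auto
  also have "exp (x * \<mu>) * exp (- \<mu>) = exp (- ((1 - x) * \<mu>))"
    by (simp add: exp_add [symmetric] algebra_simps)
  finally show ?thesis .
qed

lemma decseq_prod_lessThan:
  fixes f :: "nat \<Rightarrow> 'c \<Rightarrow> ennreal"
  assumes "\<And>i x. f i x \<le> 1"
  shows "decseq (\<lambda>n x. \<Prod>i<n. f i x)"
proof (rule decseq_SucI, rule le_funI)
  fix n x show "(\<Prod>i<Suc n. f i x) \<le> (\<Prod>i<n. f i x)"
    using mult_left_mono [OF assms, of "\<Prod>i<n. f i x" n x] by simp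
qed

text \<open>Measurability of the counts is hidden in the independence clause of
  \<open>poisson_process\<close>, which is applied here to a one-element index set.\<close>

lemma poisson_process_count_rv:
  assumes "poisson_process \<nu> P" "A \<in> sets \<nu>" "emeasure \<nu> A < \<infinity>"
  shows "(\<lambda>\<omega>. card {i. P i \<omega> \<in> A}) \<in> measurable M (count_space UNIV)"
proof -
  have "indep_vars (\<lambda>_. count_space UNIV) (\<lambda>j \<omega>. card {i. P i \<omega> \<in> A}) {0::nat}"
    using assms unfolding poisson_process_def
    by (elim conjE allE [of _ "{0}"] allE [of _ "\<lambda>_. A"]) (auto simp: disjoint_family_on_def)
  then show ?thesis by (auto simp: indep_vars_def)
qed

text \<open>Counts in disjoint sets are independent, so the expectation factorises into generating
  functions. The bijection \<open>h\<close> is there because \<open>poisson_process\<close> indexes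
  its sets by natural numbers, whereas \<open>J\<close> will later be a set of function
  values.\<close>

lemma poisson_process_laplace_simple:
  assumes P: "poisson_process \<nu> P" and A: "disjoint_family_on A J" "finite J"
    and sets: "\<And>j. j \<in> J \<Longrightarrow> A j \<in> sets \<nu>" "\<And>j. j \<in> J \<Longrightarrow> emeasure \<nu> (A j) < \<infinity>"
    and c: "\<And>j. j \<in> J \<Longrightarrow> 0 \<le> c j" "\<And>j. j \<in> J \<Longrightarrow> c j \<le> 1"
  shows "(\<integral>\<^sup>+\<omega>. (\<Prod>j\<in>J. ennreal ((1 - c j) ^ card {i. P i \<omega> \<in> A j})) \<partial>M)
      = ennreal (exp (- (\<Sum>j\<in>J. c j * measure \<nu> (A j))))"
proof -
  obtain h where h: "bij_betw h {0..<card J} J"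
    using ex_bij_betw_nat_finite [OF \<open>finite J\<close>] by blast
  let ?I = "{0..<card J}"
  have hJ: "h k \<in> J" if "k \<in> ?I" for k using h that by (auto simp: bij_betw_def)
  have disj: "disjoint_family_on (\<lambda>k. A (h k)) ?I"
    using A(1) h hJ unfolding disjoint_family_on_def
    by (metis bij_betw_def inj_on_contraD)
  have "indep_vars (\<lambda>_. count_space UNIV) (\<lambda>k \<omega>. card {i. P i \<omega> \<in> A (h k)}) ?I"
    using P disj hJ sets unfolding poisson_process_def by blast
  then have ind: "indep_vars (\<lambda>_. borel)
      (\<lambda>k \<omega>. ennreal ((1 - c (h k)) ^ card {i. P i \<omega> \<in> A (h k)})) ?I"
    by (rule indep_vars_compose2) auto
  have "(\<integral>\<^sup>+\<omega>. (\<Prod>j\<in>J. ennreal ((1 - c j) ^ card {i. P i \<omega> \<in> A j})) \<partial>M)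
      = (\<integral>\<^sup>+\<omega>. (\<Prod>k\<in>?I. ennreal ((1 - c (h k)) ^ card {i. P i \<omega> \<in> A (h k)})) \<partial>M)"
    by (intro nn_integral_cong prod.reindex_bij_betw [OF h, symmetric])
  also have "\<dots> = (\<Prod>k\<in>?I. \<integral>\<^sup>+\<omega>. ennreal ((1 - c (h k)) ^ card {i. P i \<omega> \<in> A (h k)}) \<partial>M)"
    by (intro indep_vars_nn_integral ind) auto
  also have "\<dots> = (\<Prod>j\<in>J. \<integral>\<^sup>+\<omega>. ennreal ((1 - c j) ^ card {i. P i \<omega> \<in> A j}) \<partial>M)"
    by (rule prod.reindex_bij_betw [OF h])
  also have "\<dots> = (\<Prod>j\<in>J. ennreal (exp (- (c j * measure \<nu> (A j)))))"
  proof (rule prod.cong [OF refl])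
    fix j assume j: "j \<in> J"
    show "(\<integral>\<^sup>+\<omega>. ennreal ((1 - c j) ^ card {i. P i \<omega> \<in> A j}) \<partial>M)
        = ennreal (exp (- (c j * measure \<nu> (A j))))"
      using nn_integral_power_poisson [OF poisson_process_count_rv [OF P sets [OF j]],
          of "measure \<nu> (A j)" "1 - c j"] P sets [OF j] c [OF j]
      unfolding poisson_process_def by auto
  qed
  also have "\<dots> = ennreal (exp (- (\<Sum>j\<in>J. c j * measure \<nu> (A j))))"
    by (subst prod_ennreal) (auto simp: exp_sum [OF \<open>finite J\<close>] sum_negf [symmetric])
  finally show ?thesis .
qed

text \<open>
  The infimum over \<open>n\<close> stands for the product over all points. Equality holds, but the upper
  bound only needs simple functions below \<open>g\<close>.
\<close>
lemma poisson_process_laplace: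
  fixes g :: "'b \<Rightarrow> real"
  assumes P: "poisson_process \<nu> P" and g[measurable]: "g \<in> borel_measurable \<nu>"
    and g01: "\<And>x. 0 \<le> g x" "\<And>x. g x \<le> 1"
    and mu: "(\<integral>\<^sup>+x. ennreal (g x) \<partial>\<nu>) = ennreal \<mu>" "0 \<le> \<mu>"
  shows "(INF n. \<integral>\<^sup>+\<omega>. (\<Prod>i<n. ennreal (1 - g (P i \<omega>))) \<partial>M) \<le> ennreal (exp (- \<mu>))"
    (is "?L \<le> _")
proof -
  have [measurable]: "P i \<in> measurable M \<nu>" for i
    using P by (rule poisson_process_measurable)
  \<comment> \<open>The bound is first shown for each simple \<open>s\<close> below
    \<open>g\<close>; since all its values are finite, \<open>enn2real\<close> loses
    nothing.\<close>
  have simple: "?L \<le> ennreal (exp (- enn2real (integral\<^sup>S \<nu> s)))"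
    if s: "simple_function \<nu> s" "s \<le> (\<lambda>x. ennreal (g x))" "\<forall>x. s x < top" for s
  proof -
    define V where "V = s ` space \<nu> - {0}"
    define A where "A v = s -` {v} \<inter> space \<nu>" for v
    have sm[measurable]: "s \<in> borel_measurable \<nu>" using s(1) by (rule borel_measurable_simple_function)
    have finV: "finite V" using s(1) by (simp add: V_def simple_function_def)
    have disj: "disjoint_family_on A V" by (auto simp: disjoint_family_on_def A_def)
    have Aset: "A v \<in> sets \<nu>" for v
      unfolding A_def by measurable
    have sg: "enn2real (s x) \<le> g x" for x
    proof -
      have "s x \<le> ennreal (g x)" using s(2) by (simp add: le_fun_def)
      then show ?thesis using enn2real_leI g01(1) by metis
    qed
    have s01: "0 \<le> enn2real (s x)" "enn2real (s x) \<le> 1" for x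
      using sg [of x] g01(2) [of x] by auto
    have le: "integral\<^sup>S \<nu> s \<le> ennreal \<mu>"
      using nn_integral_eq_simple_integral [OF s(1)] nn_integral_mono [of \<nu> s "\<lambda>x. ennreal (g x)"] s(2) mu(1)
      by (auto simp: le_fun_def)
    have isum: "integral\<^sup>S \<nu> s = (\<Sum>v\<in>V. v * emeasure \<nu> (A v))"
      unfolding simple_integral_def V_def A_def
      using s(1) by (intro sum.mono_neutral_right) (auto simp: simple_function_def)
    \<comment> \<open>By \<open>le\<close> a nonzero value can only be taken on a set of finite
      measure, and only for such sets is the count of points controlled. This is why 0 was removed
      from \<open>V\<close>.\<close>
    have Afin: "emeasure \<nu> (A v) < \<infinity>" if "v \<in> V" for v
    proof -
      have "v * emeasure \<nu> (A v) \<le> ennreal \<mu>"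
        using le isum member_le_sum [OF that, of "\<lambda>v. v * emeasure \<nu> (A v)"] finV
        by (metis order_trans zero_le)
      then have "v * emeasure \<nu> (A v) < \<infinity>"
        using ennreal_less_top le_less_trans by (metis infinity_ennreal_def)
      then show ?thesis
        using that by (auto simp: V_def ennreal_mult_less_top)
    qed
    have vfin: "v < top" "v = ennreal (enn2real v)" "enn2real v \<le> 1" if "v \<in> V" for v
      using that s(3) s01 by (auto simp: V_def)
    have "?L \<le> (INF n. \<integral>\<^sup>+\<omega>. (\<Prod>i<n. ennreal (1 - enn2real (s (P i \<omega>)))) \<partial>M)"
      by (intro INF_mono' nn_integral_mono prod_mono_ennreal ennreal_leI diff_mono sg order_refl)
    also have "\<dots> = (\<integral>\<^sup>+\<omega>. (INF n. \<Prod>i<n. ennreal (1 - enn2real (s (P i \<omega>)))) \<partial>M)"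
    proof (rule nn_integral_monotone_convergence_INF_decseq [symmetric, where i=0])
      show "decseq (\<lambda>n \<omega>. \<Prod>i<n. ennreal (1 - enn2real (s (P i \<omega>))))"
        by (rule decseq_prod_lessThan) (simp add: ennreal_le_1)
    qed (auto simp: emeasure_space_1)
    \<comment> \<open>Almost surely only finitely many points lie where \<open>s\<close> is nonzero.
      A partial product long enough to contain them is at most the product over these points, which
      is then grouped by the value of \<open>s\<close>.\<close>
    also have "\<dots> \<le> (\<integral>\<^sup>+\<omega>. (\<Prod>v\<in>V. ennreal ((1 - enn2real v) ^ card {i. P i \<omega> \<in> A v})) \<partial>M)"
    proof (rule nn_integral_mono_AE)
      have "AE \<omega> in M. \<forall>v\<in>V. finite {i. P i \<omega> \<in> A v}"
        using P Afin Aset by (intro AE_finite_allI finV) (auto simp: poisson_process_def)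
      then show "AE \<omega> in M. (INF n. \<Prod>i<n. ennreal (1 - enn2real (s (P i \<omega>))))
          \<le> (\<Prod>v\<in>V. ennreal ((1 - enn2real v) ^ card {i. P i \<omega> \<in> A v}))"
      proof eventually_elim
        fix \<omega> assume fin: "\<forall>v\<in>V. finite {i. P i \<omega> \<in> A v}"
        let ?U = "\<Union>v\<in>V. {i. P i \<omega> \<in> A v}"
        have "finite ?U" using fin finV by auto
        then obtain n where n: "?U \<subseteq> {..<n}"
          using finite_nat_iff_bounded by blast
        have "(INF n. \<Prod>i<n. ennreal (1 - enn2real (s (P i \<omega>)))) \<le> (\<Prod>i<n. ennreal (1 - enn2real (s (P i \<omega>))))"
          by (rule INF_lower) simp
        also have "\<dots> \<le> (\<Prod>i\<in>?U. ennreal (1 - enn2real (s (P i \<omega>))))"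
        proof -
          have "(\<Prod>i<n. ennreal (1 - enn2real (s (P i \<omega>))))
              = (\<Prod>i\<in>{..<n} - ?U. ennreal (1 - enn2real (s (P i \<omega>)))) * (\<Prod>i\<in>?U. ennreal (1 - enn2real (s (P i \<omega>))))"
            by (rule prod.subset_diff [OF n]) simp
          also have "\<dots> \<le> 1 * (\<Prod>i\<in>?U. ennreal (1 - enn2real (s (P i \<omega>))))"
            by (intro mult_right_mono prod_le_1) (auto simp: ennreal_le_1)
          finally show ?thesis by simp
        qed
        also have "\<dots> = (\<Prod>v\<in>V. \<Prod>i\<in>{i. P i \<omega> \<in> A v}. ennreal (1 - enn2real (s (P i \<omega>))))"
          using fin finV by (intro prod.UNION_disjoint) (auto simp: A_def)
        also have "\<dots> = (\<Prod>v\<in>V. ennreal ((1 - enn2real v) ^ card {i. P i \<omega> \<in> A v}))"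
        proof (rule prod.cong [OF refl])
          fix v assume v: "v \<in> V"
          have "(\<Prod>i\<in>{i. P i \<omega> \<in> A v}. ennreal (1 - enn2real (s (P i \<omega>))))
              = (\<Prod>i\<in>{i. P i \<omega> \<in> A v}. ennreal (1 - enn2real v))"
            by (intro prod.cong) (auto simp: A_def)
          then show "(\<Prod>i\<in>{i. P i \<omega> \<in> A v}. ennreal (1 - enn2real (s (P i \<omega>))))
            = ennreal ((1 - enn2real v) ^ card {i. P i \<omega> \<in> A v})"
            using vfin(3) [OF v] by (simp add: ennreal_power)
        qed
        finally show "(INF n. \<Prod>i<n. ennreal (1 - enn2real (s (P i \<omega>))))
          \<le> (\<Prod>v\<in>V. ennreal ((1 - enn2real v) ^ card {i. P i \<omega> \<in> A v}))" .
      qed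
    qed
    also have "\<dots> = ennreal (exp (- (\<Sum>v\<in>V. enn2real v * measure \<nu> (A v))))"
      using vfin Aset Afin finV disj by (intro poisson_process_laplace_simple [OF P]) auto
    also have "(\<Sum>v\<in>V. enn2real v * measure \<nu> (A v)) = enn2real (integral\<^sup>S \<nu> s)"
    proof -
      have "integral\<^sup>S \<nu> s = (\<Sum>v\<in>V. ennreal (enn2real v * measure \<nu> (A v)))"
        unfolding isum
      proof (rule sum.cong [OF refl])
        fix v assume v: "v \<in> V"
        have "emeasure \<nu> (A v) = ennreal (measure \<nu> (A v))"
          using Afin [OF v] by (simp add: emeasure_eq_ennreal_measure less_top)
        then show "v * emeasure \<nu> (A v) = ennreal (enn2real v * measure \<nu> (A v))"
          by (subst vfin(2) [OF v]) (simp add: ennreal_mult')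
      qed
      then show ?thesis by (simp add: sum_nonneg)
    qed
    finally show ?thesis .
  qed
  show ?thesis
  \<comment> \<open>If the infimum is 0 nothing remains. Otherwise it is a positive number
    \<open>l\<close>, and by \<open>simple\<close> the integral of every simple function below
    \<open>g\<close> is at most \<open>- ln l\<close>, hence so is that of \<open>g\<close>.\<close>
  proof (cases "?L = 0")
    case False
    have "?L \<le> 1"
      by (rule INF_lower2 [of 0]) (auto simp: emeasure_space_1)
    then obtain l where l: "?L = ennreal l" "0 < l"
      using False by (cases ?L rule: ennreal_cases) (auto simp: top_unique)
    have "(\<integral>\<^sup>+x. ennreal (g x) \<partial>\<nu>) \<le> ennreal (- ln l)"
      unfolding nn_integral_def_finite
    proof (rule SUP_least, clarify)
      fix s assume s: "simple_function \<nu> s" "s \<le> (\<lambda>x. ennreal (g x))" "\<forall>x. s x < top"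
      have "integral\<^sup>S \<nu> s \<le> ennreal \<mu>"
        using nn_integral_eq_simple_integral [OF s(1)] nn_integral_mono [of \<nu> s "\<lambda>x. ennreal (g x)"] s(2) mu(1)
        by (auto simp: le_fun_def)
      then have fin: "integral\<^sup>S \<nu> s = ennreal (enn2real (integral\<^sup>S \<nu> s))"
        by (metis ennreal_enn2real ennreal_less_top le_less_trans)
      have "l \<le> exp (- enn2real (integral\<^sup>S \<nu> s))"
        using simple [OF s] l by (simp add: ennreal_le_iff)
      then have "enn2real (integral\<^sup>S \<nu> s) \<le> - ln l"
        using l(2) ln_le_cancel_iff [of l "exp (- enn2real (integral\<^sup>S \<nu> s))"] by simp
      then show "integral\<^sup>S \<nu> s \<le> ennreal (- ln l)"
        by (subst fin) (rule ennreal_leI)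
    qed
    \<comment> \<open>\<open>ennreal\<close> truncates negative numbers to 0, so a negative
      \<open>- ln l\<close> would only give \<open>\<mu> = 0\<close>. Both cases are settled with
      the help of \<open>l \<le> 1\<close>.\<close>
    then have "\<mu> \<le> - ln l \<or> \<mu> = 0"
      using mu by (auto simp: ennreal_le_iff2)
    moreover have "l \<le> 1" using \<open>?L \<le> 1\<close> l by simp
    ultimately have "l \<le> exp (- \<mu>)" using l(2)
      by (metis exp_ln exp_le_cancel_iff exp_zero le_minus_iff minus_zero)
    then show ?thesis using l by simp
  qed simp
qed

end

section \<open>Independence of the sources of randomness\<close>

text \<open>Independence makes the joint law of \<open>X\<close> and \<open>Y\<close> a product
  measure, and Tonelli's theorem then allows averaging over \<open>Y\<close> with \<open>X\<close>
  frozen. The measures \<open>G\<close> and \<open>H\<close> act as carriers of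
  sub-sigma-algebras.\<close>

lemma (in prob_space) nn_integral_indep_freeze:
  fixes f :: "'b \<times> 'c \<Rightarrow> ennreal"
  assumes indep: "indep_set (sets G) (sets H)" and space: "space G = space M" "space H = space M"
    and X: "X \<in> measurable G S" and Y: "Y \<in> measurable H T"
    and f[measurable]: "f \<in> borel_measurable (S \<Otimes>\<^sub>M T)"
  shows "(\<integral>\<^sup>+\<omega>. f (X \<omega>, Y \<omega>) \<partial>M) = (\<integral>\<^sup>+\<omega>. \<integral>\<^sup>+\<omega>'. f (X \<omega>, Y \<omega>') \<partial>M \<partial>M)"
proof -
  have sub: "sets G \<subseteq> sets M" "sets H \<subseteq> sets M"
    using indep by (auto simp: indep_sets2_eq)
  have [measurable]: "X \<in> measurable M S" "Y \<in> measurable M T"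
    using measurable_mono [of S S G M] measurable_mono [of T T H M] sub space X Y by auto
  interpret X: prob_space "distr M S X" by (rule prob_space_distr) simp
  interpret Y: prob_space "distr M T Y" by (rule prob_space_distr) simp
  interpret XY: pair_prob_space "distr M S X" "distr M T Y" ..
  have eq: "distr M S X \<Otimes>\<^sub>M distr M T Y = distr M (S \<Otimes>\<^sub>M T) (\<lambda>\<omega>. (X \<omega>, Y \<omega>))"
  proof (rule pair_measure_eqI)
    fix A B assume "A \<in> sets (distr M S X)" "B \<in> sets (distr M T Y)"
    then have AB[measurable]: "A \<in> sets S" "B \<in> sets T" by auto
    have "X -` A \<inter> space M \<in> sets G" "Y -` B \<inter> space M \<in> sets H"
      using measurable_sets [OF X AB(1)] measurable_sets [OF Y AB(2)] space by auto
    then have "prob ((X -` A \<inter> space M) \<inter> (Y -` B \<inter> space M)) = prob (X -` A \<inter> space M) * prob (Y -` B \<inter> space M)"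
      by (rule indep_setD [OF indep])
    moreover have "(\<lambda>\<omega>. (X \<omega>, Y \<omega>)) -` (A \<times> B) \<inter> space M = (X -` A \<inter> space M) \<inter> (Y -` B \<inter> space M)"
      by auto
    ultimately show "emeasure (distr M S X) A * emeasure (distr M T Y) B
        = emeasure (distr M (S \<Otimes>\<^sub>M T) (\<lambda>\<omega>. (X \<omega>, Y \<omega>))) (A \<times> B)"
      by (simp add: emeasure_distr emeasure_eq_measure ennreal_mult'')
  qed (auto intro: X.sigma_finite_measure_axioms Y.sigma_finite_measure_axioms)
  have "(\<integral>\<^sup>+\<omega>. f (X \<omega>, Y \<omega>) \<partial>M) = integral\<^sup>N (distr M (S \<Otimes>\<^sub>M T) (\<lambda>\<omega>. (X \<omega>, Y \<omega>))) f"
    by (simp add: nn_integral_distr)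
  also have "\<dots> = integral\<^sup>N (distr M S X \<Otimes>\<^sub>M distr M T Y) f"
    by (simp add: eq)
  also have "\<dots> = (\<integral>\<^sup>+x. \<integral>\<^sup>+y. f (x, y) \<partial>distr M T Y \<partial>distr M S X)"
    by (rule Y.nn_integral_fst [symmetric]) simp
  also have "\<dots> = (\<integral>\<^sup>+\<omega>. \<integral>\<^sup>+\<omega>'. f (X \<omega>, Y \<omega>') \<partial>M \<partial>M)"
    by (simp add: nn_integral_distr cong: nn_integral_cong)
  finally show ?thesis .
qed

lemma (in prob_space) generated_events_subset: "generated_events N Y \<subseteq> Pow (space M)"
  using sets.space_closed [of "vimage_algebra (space M) Y N"] by (simp add: generated_events_def)

context mobile_graph
begin

section \<open>Sigma-algebras generated by groups of sources\<close>

definition sources :: "source set" where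
  "sources = {Origin_Mark, Points} \<union> range Motion \<union> {Pair i j m | i j m. i < j}"

definition source_events :: "source \<Rightarrow> 'w set set" where
  "source_events s = (case s of
          Origin_Mark \<Rightarrow> generated_events borel U0
        | Points \<Rightarrow> generated_events (PiM UNIV (\<lambda>_. borel)) (\<lambda>\<omega> i. P i \<omega>)
        | Motion i \<Rightarrow> generated_events (PiM {0..} (\<lambda>_. borel)) (\<lambda>\<omega>. \<lambda>t\<in>{0..}. B i t \<omega>)
        | Pair i j m \<Rightarrow> generated_events borel (E i j m))"

text \<open>A sigma-algebra encoded as a measure, so that \<open>measurable\<close> and
  \<open>sets\<close> apply to it. Independence concerns its sets, with probabilities taken in
  \<open>M\<close>.\<close>

definition generated_by :: "source set \<Rightarrow> 'w measure" where
  "generated_by K = sigma (space M) (\<Union>s\<in>K. source_events s)"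

lemma source_events_Pow: "source_events s \<subseteq> Pow (space M)"
  by (simp add: source_events_def generated_events_subset split: source.split)

lemma space_generated_by [simp]: "space (generated_by K) = space M"
  unfolding generated_by_def using source_events_Pow by (intro space_measure_of) auto

lemma sets_generated_by: "sets (generated_by K) = sigma_sets (space M) (\<Union>s\<in>K. source_events s)"
  unfolding generated_by_def using source_events_Pow by (intro sets_measure_of) auto

lemma Int_stable_source_events: "Int_stable (source_events s)"
  by (auto simp: source_events_def generated_events_def Int_stable_def split: source.splits)

text \<open>Each source contributes an intersection-stable family, so independence of the sources
  passes to the sigma-algebras generated by disjoint groups of them.\<close>

lemma indep_sets_generated_by:
  assumes "disjoint_family_on K J" "\<And>j. j \<in> J \<Longrightarrow> K j \<subseteq> sources"
  shows "indep_sets (\<lambda>j. sets (generated_by (K j))) J"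
  unfolding sets_generated_by
proof (rule indep_sets_collect_sigma)
  have "indep_sets source_events sources"
    using independent by (simp add: source_events_def [abs_def] sources_def)
  moreover have "(\<Union>j\<in>J. K j) \<subseteq> sources" using assms by auto
  ultimately show "indep_sets source_events (\<Union>j\<in>J. K j)"
    using indep_sets_mono_index by blast
qed (use assms Int_stable_source_events in auto)

lemma indep_set_generated_by:
  assumes "K \<inter> L = {}" "K \<subseteq> sources" "L \<subseteq> sources"
  shows "indep_set (sets (generated_by K)) (sets (generated_by L))"
proof -
  have "indep_sets (\<lambda>j. sets (generated_by (case_bool K L j))) UNIV"
    using assms by (intro indep_sets_generated_by)
      (auto simp: disjoint_family_on_def split: bool.splits)
  moreover have "(\<lambda>j. sets (generated_by (case_bool K L j)))
      = case_bool (sets (generated_by K)) (sets (generated_by L))"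
    by (auto simp: fun_eq_iff split: bool.splits)
  ultimately show ?thesis by (simp add: indep_set_def)
qed

lemma measurable_generated_by:
  assumes "s \<in> K" "source_events s = generated_events N Y" "Y \<in> space M \<rightarrow> space N"
  shows "Y \<in> measurable (generated_by K) N"
proof (rule measurableI)
  fix A assume "A \<in> sets N"
  then have "Y -` A \<inter> space M \<in> source_events s"
    unfolding assms generated_events_def by (rule in_vimage_algebra)
  then show "Y -` A \<inter> space (generated_by K) \<in> sets (generated_by K)"
    using assms(1) by (auto simp: sets_generated_by)
qed (use assms in auto)

lemma measurable_points: "Points \<in> K \<Longrightarrow> (\<lambda>\<omega> i. P i \<omega>) \<in> measurable (generated_by K) (PiM UNIV (\<lambda>_. borel))"
  by (rule measurable_generated_by [of Points]) (auto simp: source_events_def space_PiM)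

lemma measurable_point: "Points \<in> K \<Longrightarrow> P i \<in> measurable (generated_by K) borel"
  using measurable_compose [OF measurable_points measurable_component_singleton [of i]] by simp

lemma measurable_edge: "Pair i j m \<in> K \<Longrightarrow> E i j m \<in> measurable (generated_by K) borel"
  by (rule measurable_generated_by [of "Pair i j m"]) (auto simp: source_events_def)

lemma measurable_motion:
  assumes "Motion i \<in> K" "0 \<le> s"
  shows "B i s \<in> measurable (generated_by K) borel"
proof -
  have "(\<lambda>\<omega>. \<lambda>t\<in>{0..}. B i t \<omega>) \<in> measurable (generated_by K) (PiM {0..} (\<lambda>_. borel))"
    by (rule measurable_generated_by [of "Motion i"]) (use assms in \<open>auto simp: source_events_def space_PiM\<close>)
  from measurable_compose [OF this measurable_component_singleton [of s]] assms
  show ?thesis by simp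
qed

text \<open>Independence includes measurability in \<open>M\<close>; pairing \<open>K\<close> with
  the empty group of sources brings it out.\<close>

lemma sets_generated_by_subset:
  assumes "K \<subseteq> sources"
  shows "sets (generated_by K) \<subseteq> sets M"
  using indep_set_generated_by [of K "{}"] assms by (auto simp: indep_sets2_eq)

lemma measurable_generated_byD:
  assumes "X \<in> measurable (generated_by K) N" "K \<subseteq> sources"
  shows "X \<in> measurable M N"
  using measurable_mono [of N N "generated_by K" M] sets_generated_by_subset assms by auto

lemma rv_edge: "i < j \<Longrightarrow> E i j m \<in> measurable M borel"
  using measurable_edge [of i j m "{Pair i j m}"] by (rule measurable_generated_byD) (auto simp: sources_def)

lemma rv_motion: "0 \<le> s \<Longrightarrow> B i s \<in> measurable M borel"
  using measurable_motion [of i "{Motion i}" s] by (rule measurable_generated_byD) (auto simp: sources_def)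

section \<open>Initial points and laws of the motions\<close>

lemma space_vertex_intensity: "space (vertex_intensity l :: ('v \<times> real) measure) = vertex_space"
  by (simp add: vertex_intensity_def space_restrict_space space_scale_measure)

lemma point_in_vertex_space: "\<omega> \<in> space M \<Longrightarrow> P i \<omega> \<in> vertex_space"
  using measurable_space [OF poisson_process_measurable [OF points]] by (simp add: space_vertex_intensity)

text \<open>The Gaussian density is prescribed for increments. Since a motion starts at 0 almost
  surely, its position at time \<open>s\<close> has the law of its increment from time 0, which is
  the same for all \<open>i\<close>.\<close>

lemma distr_motion:
  assumes "0 < s"
  shows "distr M borel (B i s) = distr M borel (B 0 s)"
proof -
  have "distr M borel (B i s) = distr M borel (\<lambda>\<omega>. B i s \<omega> - B i 0 \<omega>)"
    and "distr M borel (\<lambda>\<omega>. B i s \<omega> - B i 0 \<omega>) =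
        density lborel (\<lambda>x. ennreal (\<Prod>b\<in>Basis. normal_density 0 (sqrt (s - 0)) (x \<bullet> b)))" for i
  proof -
    have [measurable]: "B i s \<in> measurable M borel" "B i 0 \<in> measurable M borel"
      using assms rv_motion by auto
    have "AE \<omega> in M. B i 0 \<omega> = 0"
      using motion [of i] unfolding standard_brownian_motion_def by auto
    then show "distr M borel (B i s) = distr M borel (\<lambda>\<omega>. B i s \<omega> - B i 0 \<omega>)"
      by (intro distr_cong_AE) auto
    have "distributed M lborel (\<lambda>\<omega>. B i s \<omega> - B i 0 \<omega>)
          (\<lambda>x. ennreal (\<Prod>b\<in>Basis. normal_density 0 (sqrt (s - 0)) (x \<bullet> b)))"
      using motion [of i] assms unfolding standard_brownian_motion_def by blast
    from distributed_distr_eq_density [OF this]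
    show "distr M borel (\<lambda>\<omega>. B i s \<omega> - B i 0 \<omega>) =
        density lborel (\<lambda>x. ennreal (\<Prod>b\<in>Basis. normal_density 0 (sqrt (s - 0)) (x \<bullet> b)))"
      by (subst distr_cong [of M M borel lborel]) auto
  qed
  then show ?thesis by metis
qed

end

section \<open>The moved vertices seen from the origin vertex\<close>

context mobile_graph
begin

text \<open>Positions are taken relative to the origin vertex at the same time, so that regions
  around it become deterministic. The index \<open>i\<close> is that of the Poisson point, whose
  vertex is \<open>Suc i\<close>.\<close>

definition relative_vertex :: "real \<Rightarrow> 'w \<Rightarrow> nat \<Rightarrow> 'v \<times> real" where
  "relative_vertex s \<omega> i = (fst (P i \<omega>) + B (Suc i) s \<omega> - B 0 s \<omega>, snd (P i \<omega>))"

text \<open>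
  All motions have the same law at a fixed positive time, so that of the origin vertex may stand
  for any of them.
\<close>
definition hit_prob :: "real \<Rightarrow> 'v set \<Rightarrow> 'v \<Rightarrow> 'v \<Rightarrow> ennreal" where
  "hit_prob s C y x = (\<integral>\<^sup>+w. indicator C (x + w - y) \<partial>distr M borel (B 0 s))"

lemma sigma_finite_motion:
  "0 < s \<Longrightarrow> sigma_finite_measure (distr M borel (B 0 s))"
  using prob_space_imp_sigma_finite [OF prob_space_distr [OF rv_motion]] by simp

lemma hit_prob_le_1: "0 < s \<Longrightarrow> hit_prob s C y x \<le> 1"
proof -
  assume s: "0 < s"
  interpret D: prob_space "distr M borel (B 0 s)" by (intro prob_space_distr rv_motion) (use s in auto)
  have "hit_prob s C y x \<le> (\<integral>\<^sup>+w. 1 \<partial>distr M borel (B 0 s))"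
    unfolding hit_prob_def by (intro nn_integral_mono) (auto simp: indicator_def)
  then show ?thesis using D.emeasure_space_1 by simp
qed

lemma measurable_hit_prob:
  assumes "0 < s" and C[measurable]: "C \<in> sets borel"
  shows "(\<lambda>(y, x). hit_prob s C y x) \<in> borel_measurable (borel \<Otimes>\<^sub>M borel)"
proof -
  interpret sigma_finite_measure "distr M borel (B 0 s)" using assms(1) by (rule sigma_finite_motion)
  show ?thesis unfolding hit_prob_def split_beta' by measurable
qed

text \<open>When the starting point is integrated first, translation invariance gives the volume of
  \<open>C\<close> whatever the displacement \<open>w\<close> and the shift \<open>y\<close>. Hence
  the motion leaves the intensity unchanged.\<close>

lemma nn_integral_hit_prob:
  assumes "0 < s" and C[measurable]: "C \<in> sets borel"
  shows "(\<integral>\<^sup>+x. hit_prob s C y x \<partial>lborel) = emeasure lborel C"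
proof -
  interpret D: prob_space "distr M borel (B 0 s)" by (intro prob_space_distr rv_motion) (use assms in auto)
  interpret pair_sigma_finite lborel "distr M borel (B 0 s)" ..
  have "(\<integral>\<^sup>+x. hit_prob s C y x \<partial>lborel)
      = (\<integral>\<^sup>+w. \<integral>\<^sup>+x. indicator C (x + w - y) \<partial>lborel \<partial>distr M borel (B 0 s))"
    unfolding hit_prob_def by (rule Fubini' [symmetric]) measurable
  also have "\<dots> = (\<integral>\<^sup>+w. emeasure lborel C \<partial>distr M borel (B 0 s))"
  proof (rule nn_integral_cong)
    fix w
    have "(\<integral>\<^sup>+x. indicator C (x + w - y) \<partial>lborel) = (\<integral>\<^sup>+x. indicator C ((w - y) + x) \<partial>lborel)"
      by (simp add: algebra_simps)
    also have "\<dots> = (\<integral>\<^sup>+x. indicator C x \<partial>distr lborel borel ((+) (w - y)))"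
      by (subst nn_integral_distr) auto
    also have "\<dots> = emeasure lborel C"
      by (simp add: lborel_distr_plus)
    finally show "(\<integral>\<^sup>+x. indicator C (x + w - y) \<partial>lborel) = emeasure lborel C" .
  qed
  also have "\<dots> = emeasure lborel C"
    using D.emeasure_space_1 by simp
  finally show ?thesis .
qed

lemma nn_integral_vertex_intensity:
  fixes f :: "'v \<Rightarrow> ennreal"
  assumes [measurable]: "f \<in> borel_measurable borel" and "0 \<le> a" "a \<le> b" "b \<le> 1" "0 \<le> l"
  shows "(\<integral>\<^sup>+z. f (fst z) * indicator {a<..<b} (snd z) \<partial>vertex_intensity l)
      = ennreal l * (integral\<^sup>N lborel f * ennreal (b - a))"
proof -
  have [measurable]: "vertex_space \<in> sets (borel :: ('v \<times> real) measure)"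
    unfolding vertex_space_def by (simp add: borel_Times)
  have [measurable]: "(\<lambda>z. f (fst z) * indicator {a<..<b} (snd z)) \<in> borel_measurable (borel :: ('v \<times> real) measure)"
    unfolding borel_prod [symmetric] by measurable
  have "(\<integral>\<^sup>+z. f (fst z) * indicator {a<..<b} (snd z) \<partial>vertex_intensity l)
      = ennreal l * (\<integral>\<^sup>+z. (f (fst z) * indicator {a<..<b} (snd z)) * indicator vertex_space z \<partial>lborel)"
    unfolding vertex_intensity_def
    by (subst nn_integral_scale_measure)
      (auto intro!: measurable_restrict_space1 simp: nn_integral_restrict_space)
  \<comment> \<open>Since \<open>{a<..<b}\<close> lies in the open unit interval, restricting to
    \<open>vertex_space\<close> changes nothing.\<close>
  also have "(\<integral>\<^sup>+z. (f (fst z) * indicator {a<..<b} (snd z)) * indicator vertex_space z \<partial>lborel)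
      = (\<integral>\<^sup>+z. f (fst z) * indicator {a<..<b} (snd z) \<partial>(lborel \<Otimes>\<^sub>M lborel))"
    unfolding lborel_prod using assms
    by (intro nn_integral_cong) (auto simp: indicator_def vertex_space_def)
  also have "\<dots> = (\<integral>\<^sup>+x. \<integral>\<^sup>+u. f x * indicator {a<..<b} u \<partial>lborel \<partial>lborel)"
    by (subst lborel.nn_integral_fst [symmetric]) auto
  also have "\<dots> = integral\<^sup>N lborel f * ennreal (b - a)"
    using assms by (simp add: nn_integral_cmult nn_integral_multc)
  finally show ?thesis .
qed

text \<open>The moved points behave like a Poisson process of the same intensity, even relative to
  the moving origin vertex. Averaging over their motions turns the indicator into the function
  \<open>G\<close> of the initial point; once the origin motion is frozen, this is a valid argument
  of the Laplace functional. The factor \<open>h\<close> will be the success probability attached to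
  each point.\<close>

lemma moved_points_laplace:
  assumes s: "0 < s" and C[measurable]: "C \<in> sets borel" and Cfin: "emeasure lborel C = ennreal m" "0 \<le> m"
    and ab: "0 \<le> a" "a \<le> b" "b \<le> 1" and h: "0 \<le> h" "h \<le> 1"
  shows "(INF n. \<integral>\<^sup>+\<omega>. (\<Prod>i<n. ennreal (1 - h * indicator (C \<times> {a<..<b}) (relative_vertex s \<omega> i))) \<partial>M)
    \<le> ennreal (exp (- (h * lam * m * (b - a))))"
proof -
  define I where "I = {a<..<b}"
  have [measurable]: "I \<in> sets borel" by (simp add: I_def)
  define G where "G y z = h * indicator I (snd z) * enn2real (hit_prob s C y (fst z))"
    for y :: 'v and z :: "'v \<times> real"
  note mhp[measurable] = measurable_hit_prob [OF s C]
  have hp: "0 \<le> enn2real (hit_prob s C y x)" "enn2real (hit_prob s C y x) \<le> 1"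
    "ennreal (enn2real (hit_prob s C y x)) = hit_prob s C y x" for y x
    using hit_prob_le_1 [OF s, of C y x] enn2real_leI [of 1 "hit_prob s C y x"]
    by (auto simp: less_top [symmetric] top_unique intro!: ennreal_enn2real)
  have G01: "0 \<le> G y z" "G y z \<le> 1" for y z
    unfolding G_def using h hp [of y "fst z"] by (auto simp: indicator_def mult_le_one)
  have mG: "(\<lambda>(y, z). G y z) \<in> borel_measurable (borel \<Otimes>\<^sub>M (borel \<Otimes>\<^sub>M borel))"
    unfolding G_def split_beta' by measurable
  have mG'[measurable]: "(\<lambda>(y, z). G y z) \<in> borel_measurable (borel \<Otimes>\<^sub>M borel)"
    using mG unfolding borel_prod .
  have mB[measurable]: "B i s \<in> measurable M borel" for i
    using s by (intro rv_motion) simp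
  let ?S = "PiM UNIV (\<lambda>_. borel) :: (nat \<Rightarrow> 'v \<times> real) measure"
  have mP[measurable]: "(\<lambda>\<omega> i. P i \<omega>) \<in> measurable M ?S"
    using measurable_points [of "{Points}"] by (rule measurable_generated_byD) (auto simp: sources_def)
  \<comment> \<open>The initial points and the origin motion are frozen. The motions of the other
    vertices are independent of them and of each other, so their average factorises.\<close>
  have step1: "(\<integral>\<^sup>+\<omega>. (\<Prod>i<n. ennreal (1 - h * indicator (C \<times> I) (relative_vertex s \<omega> i))) \<partial>M)
      = (\<integral>\<^sup>+\<omega>. (\<Prod>i<n. ennreal (1 - G (B 0 s \<omega>) (P i \<omega>))) \<partial>M)" for n
  proof -
    let ?K = "{Points, Motion 0}" and ?L = "Motion ` {1..}"
    let ?T = "PiM {..<n} (\<lambda>_. borel) :: (nat \<Rightarrow> 'v) measure"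
    define f where "f = (\<lambda>((p, y), w). \<Prod>i<n. ennreal (1 - h * (indicator I (snd (p i)) * indicator C (fst (p i) + w i - y))))"
    have X: "(\<lambda>\<omega>. ((\<lambda>i. P i \<omega>), B 0 s \<omega>)) \<in> measurable (generated_by ?K) (?S \<Otimes>\<^sub>M borel)"
      using s by (intro measurable_Pair measurable_points measurable_motion) auto
    have Y: "(\<lambda>\<omega>. \<lambda>i\<in>{..<n}. B (Suc i) s \<omega>) \<in> measurable (generated_by ?L) ?T"
      using s by (intro measurable_restrict measurable_motion) auto
    have f[measurable]: "f \<in> borel_measurable ((?S \<Otimes>\<^sub>M borel) \<Otimes>\<^sub>M ?T)"
    proof -
      have *: "(\<lambda>x. fst (fst x) i) \<in> measurable ((?S \<Otimes>\<^sub>M borel) \<Otimes>\<^sub>M ?T) (borel \<Otimes>\<^sub>M borel)" for i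
        unfolding borel_prod by measurable
      note measurable_compose [OF * measurable_fst, measurable] measurable_compose [OF * measurable_snd, measurable]
      show ?thesis unfolding f_def split_beta' by measurable
    qed
    have "(\<integral>\<^sup>+\<omega>. (\<Prod>i<n. ennreal (1 - h * indicator (C \<times> I) (relative_vertex s \<omega> i))) \<partial>M)
      = (\<integral>\<^sup>+\<omega>. f (((\<lambda>i. P i \<omega>), B 0 s \<omega>), \<lambda>i\<in>{..<n}. B (Suc i) s \<omega>) \<partial>M)"
      by (simp add: f_def relative_vertex_def indicator_times mult.commute)
    also have "\<dots> = (\<integral>\<^sup>+\<omega>. \<integral>\<^sup>+\<omega>'. f (((\<lambda>i. P i \<omega>), B 0 s \<omega>), \<lambda>i\<in>{..<n}. B (Suc i) s \<omega>') \<partial>M \<partial>M)"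
      by (rule nn_integral_indep_freeze [OF indep_set_generated_by [of ?K ?L] _ _ X Y f])
        (auto simp: sources_def)
    also have "\<dots> = (\<integral>\<^sup>+\<omega>. (\<Prod>i<n. ennreal (1 - G (B 0 s \<omega>) (P i \<omega>))) \<partial>M)"
    proof (rule nn_integral_cong)
      fix \<omega>
      have "indep_sets (\<lambda>i. sets (generated_by {Motion (Suc i)})) {..<n}"
        by (intro indep_sets_generated_by) (auto simp: disjoint_family_on_def sources_def)
      then have "indep_vars (\<lambda>_. borel) (\<lambda>i \<omega>'. B (Suc i) s \<omega>') {..<n}"
        unfolding indep_vars_def2
      proof (intro conjI ballI mB, elim indep_sets_mono_sets)
        fix i
        have "B (Suc i) s \<in> measurable (generated_by {Motion (Suc i)}) borel"
          using s by (intro measurable_motion) auto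
        then show "{B (Suc i) s -` A \<inter> space M |A. A \<in> sets borel} \<subseteq> sets (generated_by {Motion (Suc i)})"
          by (auto dest: measurable_sets)
      qed
      then have ind: "indep_vars (\<lambda>_. borel) (\<lambda>i \<omega>'. ennreal (1 - h * (indicator I (snd (P i \<omega>))
           * indicator C (fst (P i \<omega>) + B (Suc i) s \<omega>' - B 0 s \<omega>)))) {..<n}"
        by (rule indep_vars_compose2) measurable
      have "(\<integral>\<^sup>+\<omega>'. f (((\<lambda>i. P i \<omega>), B 0 s \<omega>), \<lambda>i\<in>{..<n}. B (Suc i) s \<omega>') \<partial>M)
        = (\<integral>\<^sup>+\<omega>'. (\<Prod>i<n. ennreal (1 - h * (indicator I (snd (P i \<omega>))
           * indicator C (fst (P i \<omega>) + B (Suc i) s \<omega>' - B 0 s \<omega>)))) \<partial>M)"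
        by (simp add: f_def)
      also have "\<dots> = (\<Prod>i<n. \<integral>\<^sup>+\<omega>'. ennreal (1 - h * (indicator I (snd (P i \<omega>))
           * indicator C (fst (P i \<omega>) + B (Suc i) s \<omega>' - B 0 s \<omega>))) \<partial>M)"
        by (intro indep_vars_nn_integral ind) auto
      also have "\<dots> = (\<Prod>i<n. ennreal (1 - G (B 0 s \<omega>) (P i \<omega>)))"
      proof (rule prod.cong [OF refl])
        fix i
        define x where "x = fst (P i \<omega>)"
        define y where "y = B 0 s \<omega>"
        have hpe: "hit_prob s C y x = ennreal (\<integral>\<omega>'. indicator C (x + B (Suc i) s \<omega>' - y) \<partial>M)"
        proof -
          have "hit_prob s C y x = (\<integral>\<^sup>+w. indicator C (x + w - y) \<partial>distr M borel (B (Suc i) s))"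
            unfolding hit_prob_def using distr_motion [OF s, of "Suc i"] by simp
          also have "\<dots> = (\<integral>\<^sup>+\<omega>'. ennreal (indicator C (x + B (Suc i) s \<omega>' - y)) \<partial>M)"
            by (subst nn_integral_distr) (auto simp: ennreal_indicator)
          also have "\<dots> = ennreal (\<integral>\<omega>'. indicator C (x + B (Suc i) s \<omega>' - y) \<partial>M)"
            by (intro nn_integral_eq_integral integrable_const_bound [where B=1]) auto
          finally show ?thesis .
        qed
        have "(\<integral>\<^sup>+\<omega>'. ennreal (1 - h * (indicator I (snd (P i \<omega>)) * indicator C (x + B (Suc i) s \<omega>' - y))) \<partial>M)
            = ennreal (\<integral>\<omega>'. (1 - h * (indicator I (snd (P i \<omega>)) * indicator C (x + B (Suc i) s \<omega>' - y))) \<partial>M)"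
          using h by (intro nn_integral_eq_integral integrable_const_bound [where B=1])
            (auto simp: indicator_def)
        also have "(\<integral>\<omega>'. (1 - h * (indicator I (snd (P i \<omega>)) * indicator C (x + B (Suc i) s \<omega>' - y))) \<partial>M)
            = 1 - h * (indicator I (snd (P i \<omega>)) * (\<integral>\<omega>'. indicator C (x + B (Suc i) s \<omega>' - y) \<partial>M))"
          by (subst Bochner_Integration.integral_diff)
            (auto intro!: integrable_const_bound [where B=1] simp: prob_space)
        also have "\<dots> = 1 - G y (P i \<omega>)"
          by (simp add: G_def x_def [symmetric] hpe integral_nonneg)
        finally show "(\<integral>\<^sup>+\<omega>'. ennreal (1 - h * (indicator I (snd (P i \<omega>))
           * indicator C (fst (P i \<omega>) + B (Suc i) s \<omega>' - B 0 s \<omega>))) \<partial>M) = ennreal (1 - G (B 0 s \<omega>) (P i \<omega>))"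
          by (simp add: x_def y_def)
      qed
      finally show "(\<integral>\<^sup>+\<omega>'. f (((\<lambda>i. P i \<omega>), B 0 s \<omega>), \<lambda>i\<in>{..<n}. B (Suc i) s \<omega>') \<partial>M)
        = (\<Prod>i<n. ennreal (1 - G (B 0 s \<omega>) (P i \<omega>)))" .
    qed
    finally show ?thesis .
  qed
  \<comment> \<open>Now the origin motion is frozen and the average runs over the points
    alone.\<close>
  have step2: "(\<integral>\<^sup>+\<omega>. (\<Prod>i<n. ennreal (1 - G (B 0 s \<omega>) (P i \<omega>))) \<partial>M)
      = (\<integral>\<^sup>+\<omega>. \<integral>\<^sup>+\<omega>'. (\<Prod>i<n. ennreal (1 - G (B 0 s \<omega>) (P i \<omega>'))) \<partial>M \<partial>M)" for n
  proof -
    let ?K = "{Motion 0}" and ?L = "{Points}"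
    define f where "f = (\<lambda>(y, p). \<Prod>i<n. ennreal (1 - G y (p i)))"
    have f[measurable]: "f \<in> borel_measurable (borel \<Otimes>\<^sub>M ?S)"
      unfolding f_def split_beta' by measurable
    have "(\<integral>\<^sup>+\<omega>. f (B 0 s \<omega>, \<lambda>i. P i \<omega>) \<partial>M) = (\<integral>\<^sup>+\<omega>. \<integral>\<^sup>+\<omega>'. f (B 0 s \<omega>, \<lambda>i. P i \<omega>') \<partial>M \<partial>M)"
      using s by (intro nn_integral_indep_freeze [OF indep_set_generated_by [of ?K ?L] _ _ _ _ f]
         measurable_points measurable_motion) (auto simp: sources_def)
    then show ?thesis by (simp add: f_def)
  qed
  have mF[measurable]: "(\<lambda>\<omega>. \<integral>\<^sup>+\<omega>'. (\<Prod>i<n. ennreal (1 - G (B 0 s \<omega>) (P i \<omega>'))) \<partial>M) \<in> borel_measurable M" for n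
    by measurable
  \<comment> \<open>The integral of \<open>G y\<close> is the same for every position
    \<open>y\<close> of the origin vertex, so this bound is uniform in \<open>y\<close>.\<close>
  have bound: "(INF n. \<integral>\<^sup>+\<omega>'. (\<Prod>i<n. ennreal (1 - G y (P i \<omega>'))) \<partial>M) \<le> ennreal (exp (- (h * lam * m * (b - a))))" for y
  proof (rule poisson_process_laplace [OF points _ G01])
    have [measurable]: "hit_prob s C y \<in> borel_measurable borel"
      using measurable_compose [OF measurable_Pair1' mhp, of y] by simp
    have "G y \<in> borel_measurable lborel"
      by measurable
    then have "G y \<in> borel_measurable (restrict_space lborel vertex_space)"
      by (rule measurable_restrict_space1)
    moreover have "measurable (vertex_intensity lam) borel
        = measurable (restrict_space lborel (vertex_space :: ('v \<times> real) set)) (borel :: real measure)"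
      by (intro measurable_cong_sets) (simp_all add: vertex_intensity_def)
    ultimately show "G y \<in> borel_measurable (vertex_intensity lam)"
      by metis
    have "(\<integral>\<^sup>+z. ennreal (G y z) \<partial>vertex_intensity lam)
        = (\<integral>\<^sup>+z. (ennreal h * hit_prob s C y (fst z)) * indicator {a<..<b} (snd z) \<partial>vertex_intensity lam)"
      using h hp by (intro nn_integral_cong) (auto simp: G_def I_def indicator_def ennreal_mult)
    also have "\<dots> = ennreal lam * ((\<integral>\<^sup>+x. ennreal h * hit_prob s C y x \<partial>lborel) * ennreal (b - a))"
      using ab intensity_pos by (intro nn_integral_vertex_intensity) auto
    also have "\<dots> = ennreal lam * (ennreal h * ennreal m * ennreal (b - a))"
      using Cfin by (simp add: nn_integral_cmult nn_integral_hit_prob [OF s C])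
    also have "\<dots> = ennreal (h * lam * m * (b - a))"
      using h Cfin ab intensity_pos by (simp add: ennreal_mult' [symmetric] ennreal_mult'' [symmetric] mult_ac)
    finally show "(\<integral>\<^sup>+z. ennreal (G y z) \<partial>vertex_intensity lam) = ennreal (h * lam * m * (b - a))" .
    show "0 \<le> h * lam * m * (b - a)" using h Cfin ab intensity_pos by simp
  qed
  have "(INF n. \<integral>\<^sup>+\<omega>. (\<Prod>i<n. ennreal (1 - h * indicator (C \<times> I) (relative_vertex s \<omega> i))) \<partial>M)
      = (INF n. \<integral>\<^sup>+\<omega>. \<integral>\<^sup>+\<omega>'. (\<Prod>i<n. ennreal (1 - G (B 0 s \<omega>) (P i \<omega>'))) \<partial>M \<partial>M)"
    unfolding step1 step2 ..
  \<comment> \<open>Monotone convergence moves the infimum inside the average over the origin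
    motion, where \<open>bound\<close> applies pointwise.\<close>
  also have "\<dots> = (\<integral>\<^sup>+\<omega>. (INF n. \<integral>\<^sup>+\<omega>'. (\<Prod>i<n. ennreal (1 - G (B 0 s \<omega>) (P i \<omega>'))) \<partial>M) \<partial>M)"
  proof (rule nn_integral_monotone_convergence_INF_decseq [symmetric, where i=0])
    have "(\<Prod>i<Suc n. ennreal (1 - G y (P i \<omega>'))) \<le> (\<Prod>i<n. ennreal (1 - G y (P i \<omega>')))" for n y \<omega>'
      using mult_left_mono [of "ennreal (1 - G y (P n \<omega>'))" 1 "\<Prod>i<n. ennreal (1 - G y (P i \<omega>'))"] G01
      by (simp add: ennreal_le_1)
    then show "decseq (\<lambda>n \<omega>. \<integral>\<^sup>+\<omega>'. (\<Prod>i<n. ennreal (1 - G (B 0 s \<omega>) (P i \<omega>'))) \<partial>M)"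
      by (intro decseq_SucI le_funI nn_integral_mono)
  qed (auto simp: emeasure_space_1)
  also have "\<dots> \<le> (\<integral>\<^sup>+\<omega>. ennreal (exp (- (h * lam * m * (b - a)))) \<partial>M)"
    by (intro nn_integral_mono bound)
  finally show ?thesis by (simp add: I_def emeasure_space_1)
qed

end

section \<open>Edges given the vertices\<close>

lemma outer_measure_of_le: "A \<subseteq> B \<Longrightarrow> B \<in> sets M \<Longrightarrow> outer_measure_of M A \<le> emeasure M B"
  using outer_measure_of_mono [of A B M] by simp

text \<open>The event is cut along the countably many values of \<open>D\<close>. Each piece belongs
  to \<open>G\<close> and is therefore independent of \<open>Z d\<close>; afterwards the pieces are
  put together again as one integral. The predicate \<open>Q\<close> carries the conditions under
  which \<open>D\<close> is meaningful.\<close>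

lemma (in prob_space) emeasure_freeze_countable:
  fixes D :: "'a \<Rightarrow> 'd"
  assumes indep: "indep_set (sets G) (sets H)" and S: "countable S"
    and D: "\<And>d. d \<in> S \<Longrightarrow> {\<omega> \<in> space M. Q \<omega> \<and> D \<omega> = d} \<in> sets G"
    and Z: "\<And>d. d \<in> S \<Longrightarrow> Z d \<in> sets H" "\<And>d. d \<in> S \<Longrightarrow> prob (Z d) \<le> f d"
    and f: "\<And>d. 0 \<le> f d"
  shows "emeasure M {\<omega> \<in> space M. Q \<omega> \<and> D \<omega> \<in> S \<and> \<omega> \<in> Z (D \<omega>)}
      \<le> (\<integral>\<^sup>+\<omega>. ennreal (f (D \<omega>)) * indicator {\<omega>. Q \<omega> \<and> D \<omega> \<in> S} \<omega> \<partial>M)"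
proof -
  have sub: "sets G \<subseteq> sets M" "sets H \<subseteq> sets M"
    using indep by (auto simp: indep_sets2_eq)
  define A where "A d = {\<omega> \<in> space M. Q \<omega> \<and> D \<omega> = d}" for d
  have A[measurable]: "A d \<in> sets M" "A d \<in> sets G" if "d \<in> S" for d
    using D [OF that] sub by (auto simp: A_def)
  have [measurable]: "Z d \<in> sets M" if "d \<in> S" for d
    using Z that sub by auto
  have "{\<omega> \<in> space M. Q \<omega> \<and> D \<omega> \<in> S \<and> \<omega> \<in> Z (D \<omega>)} = (\<Union>d\<in>S. A d \<inter> Z d)"
    by (auto simp: A_def)
  then have "emeasure M {\<omega> \<in> space M. Q \<omega> \<and> D \<omega> \<in> S \<and> \<omega> \<in> Z (D \<omega>)}
      = (\<integral>\<^sup>+d. emeasure M (A d \<inter> Z d) \<partial>count_space S)"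
    by (subst emeasure_UN_countable [OF _ S, symmetric])
       (auto simp: disjoint_family_on_def A_def [abs_def] intro!: sets.Int A [unfolded A_def])
  also have "\<dots> \<le> (\<integral>\<^sup>+d. \<integral>\<^sup>+\<omega>. ennreal (f d) * indicator (A d) \<omega> \<partial>M \<partial>count_space S)"
  proof (rule nn_integral_mono)
    fix d assume "d \<in> space (count_space S)"
    then have d: "d \<in> S" by simp
    have "emeasure M (A d \<inter> Z d) = ennreal (prob (A d) * prob (Z d))"
      using indep_setD [OF indep A(2) [OF d] Z(1) [OF d]] by (simp add: emeasure_eq_measure)
    also have "\<dots> \<le> ennreal (f d * prob (A d))"
      using mult_right_mono [OF Z(2) [OF d], of "prob (A d)"] by (intro ennreal_leI) (simp add: mult.commute)
    also have "\<dots> = (\<integral>\<^sup>+\<omega>. ennreal (f d) * indicator (A d) \<omega> \<partial>M)"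
      using f [of d] A(1) [OF d] by (simp add: nn_integral_cmult_indicator emeasure_eq_measure ennreal_mult')
    finally show "emeasure M (A d \<inter> Z d) \<le> (\<integral>\<^sup>+\<omega>. ennreal (f d) * indicator (A d) \<omega> \<partial>M)" .
  qed
  also have "\<dots> = (\<integral>\<^sup>+\<omega>. \<integral>\<^sup>+d. ennreal (f d) * indicator (A d) \<omega> \<partial>count_space S \<partial>M)"
    using A by (intro nn_integral_count_space_nn_integral [OF S, symmetric]) auto
  also have "\<dots> = (\<integral>\<^sup>+\<omega>. ennreal (f (D \<omega>)) * indicator {\<omega>. Q \<omega> \<and> D \<omega> \<in> S} \<omega> \<partial>M)"
  proof (rule nn_integral_cong)
    fix \<omega> assume \<omega>: "\<omega> \<in> space M"
    have "(\<integral>\<^sup>+d. ennreal (f d) * indicator (A d) \<omega> \<partial>count_space S)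
        = (\<integral>\<^sup>+d. (ennreal (f (D \<omega>)) * indicator {\<omega>. Q \<omega> \<and> D \<omega> \<in> S} \<omega>) * indicator {D \<omega>} d \<partial>count_space S)"
      using \<omega> by (intro nn_integral_cong) (auto simp: A_def indicator_def)
    also have "\<dots> = ennreal (f (D \<omega>)) * indicator {\<omega>. Q \<omega> \<and> D \<omega> \<in> S} \<omega>"
    proof (cases "D \<omega> \<in> S")
      case True
      then show ?thesis by (subst nn_integral_cmult_indicator) auto
    next
      case False
      then show ?thesis by simp
    qed
    finally show "(\<integral>\<^sup>+d. ennreal (f d) * indicator (A d) \<omega> \<partial>count_space S)
        = ennreal (f (D \<omega>)) * indicator {\<omega>. Q \<omega> \<and> D \<omega> \<in> S} \<omega>" .
  qed
  finally show ?thesis .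
qed

lemma (in prob_space) prob_uniform01_less:
  assumes "uniform01 Y" "0 \<le> q" "q \<le> 1"
  shows "prob {\<omega> \<in> space M. Y \<omega> < q} = q"
proof -
  have Y: "Y \<in> measurable M borel" and d: "distr M borel Y = uniform_measure lborel {0<..<1}"
    using assms by (auto simp: uniform01_def)
  have "prob {\<omega> \<in> space M. Y \<omega> < q} = measure (distr M borel Y) {..<q}"
    using Y by (subst measure_distr) (auto intro!: arg_cong [where f=prob])
  also have "\<dots> = q"
  proof -
    have "{0<..<1} \<inter> {..<q} = {0<..<q}" using assms by auto
    then show ?thesis
      unfolding d using assms measure_uniform_measure [of "lborel :: real measure" "{0<..<1}" "{..<q}"] by simp
  qed
  finally show ?thesis .
qed

context mobile_graph
begin

section \<open>Vertex sources and edge variables\<close>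

definition vertex_sources :: "source set" where
  "vertex_sources = {Points} \<union> range Motion"

lemma vertex_sources_subset: "vertex_sources \<subseteq> sources"
  by (auto simp: vertex_sources_def sources_def)

lemma measurable_relative_vertex:
  assumes "0 \<le> s"
  shows "(\<lambda>\<omega>. relative_vertex s \<omega> i) \<in> measurable (generated_by vertex_sources) borel"
proof -
  have [measurable]: "P i \<in> measurable (generated_by vertex_sources) (borel \<Otimes>\<^sub>M borel)"
    unfolding borel_prod by (rule measurable_point) (simp add: vertex_sources_def)
  have [measurable]: "B j s \<in> measurable (generated_by vertex_sources) borel" for j
    using assms by (intro measurable_motion) (auto simp: vertex_sources_def)
  show ?thesis unfolding relative_vertex_def borel_prod [symmetric] by measurable
qed

text \<open>Symmetric access to variables that are stored with the smaller index first:
  \<open>pair k i j\<close> is the source of \<open>edge k i j\<close>. The arguments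
  \<open>i\<close> and \<open>j\<close> are vertex indices, so the Poisson point \<open>w\<close>
  enters as \<open>Suc w\<close>.\<close>

definition pair :: "nat \<Rightarrow> nat \<Rightarrow> nat \<Rightarrow> source" where
  "pair k i j = Pair (min i j) (max i j) k"

definition edge :: "nat \<Rightarrow> nat \<Rightarrow> nat \<Rightarrow> 'w \<Rightarrow> real" where
  "edge k i j = E (min i j) (max i j) k"

lemma pair_in_sources: "i \<noteq> j \<Longrightarrow> pair k i j \<in> sources"
  by (auto simp: pair_def sources_def min_def max_def)

lemma pair_eq_iff: "pair k i j = pair k' i' j' \<longleftrightarrow> k = k' \<and> {i, j} = {i', j'}"
  by (auto simp: pair_def min_def max_def doubleton_eq_iff)

lemma measurable_edge_value: "pair k i j \<in> K \<Longrightarrow> edge k i j \<in> measurable (generated_by K) borel"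
  unfolding edge_def pair_def by (rule measurable_edge)

lemma rv_edge_value: "i \<noteq> j \<Longrightarrow> edge k i j \<in> measurable M borel"
  unfolding edge_def by (rule rv_edge) auto

lemma prob_edge_less:
  assumes "i \<noteq> j" "0 \<le> q" "q \<le> 1"
  shows "prob {\<omega> \<in> space M. edge k i j \<omega> < q} = q"
  unfolding edge_def using assms by (intro prob_uniform01_less edge_uniform) auto

lemma measurable_edge_set:
  "pair k i j \<in> K \<Longrightarrow> {\<omega> \<in> space M. edge k i j \<omega> < q} \<in> sets (generated_by K)"
  using measurable_sets [OF measurable_edge_value, of k i j K "{..<q}"]
  by (simp add: vimage_def Int_def conj_commute)

lemma sets_generated_by_mono: "K \<subseteq> L \<Longrightarrow> sets (generated_by K) \<subseteq> sets (generated_by L)"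
  unfolding sets_generated_by by (intro sigma_sets_mono') auto

text \<open>Paths from \<open>a\<close> to \<open>b\<close> through different \<open>w\<close> use
  different pairs, because \<open>a\<close> and \<open>b\<close> are distinct and lie outside
  \<open>U\<close>. Their failures are therefore independent, each of probability
  \<open>1 - q1 * q2\<close>.\<close>

lemma prob_no_path:
  fixes k :: nat
  assumes U: "finite U" "a \<noteq> b" "a \<notin> U" "b \<notin> U"
    and q: "0 \<le> q1" "q1 \<le> 1" "0 \<le> q2" "q2 \<le> 1"
  defines "Z \<equiv> {\<omega> \<in> space M. \<forall>w\<in>U. \<not> (edge k a w \<omega> < q1 \<and> edge k w b \<omega> < q2)}"
    and "K \<equiv> \<Union>w\<in>U. {pair k a w, pair k w b}"
  shows "Z \<in> sets (generated_by K)" and "prob Z = (1 - q1 * q2) ^ card U"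
proof -
  define Y where "Y w = space M - {\<omega> \<in> space M. edge k a w \<omega> < q1} \<inter> {\<omega> \<in> space M. edge k w b \<omega> < q2}" for w
  have Yset: "Y w \<in> sets (generated_by K')" if "{pair k a w, pair k w b} \<subseteq> K'" for w K'
    unfolding Y_def using that sets.top [of "generated_by K'"]
    by (auto intro!: sets.Diff sets.Int measurable_edge_set)
  have ZY: "Z = (if U = {} then space M else (\<Inter>w\<in>U. Y w))"
    by (auto simp: Z_def Y_def)
  show "Z \<in> sets (generated_by K)"
    unfolding ZY using U(1) sets.top [of "generated_by K"]
    by (auto intro!: sets.finite_INT Yset simp: K_def simp del: sets.top)
  show "prob Z = (1 - q1 * q2) ^ card U"
  proof (cases "U = {}")
    case False
    have "indep_sets (\<lambda>w. sets (generated_by {pair k a w, pair k w b})) U"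
      using U by (intro indep_sets_generated_by)
        (auto simp: disjoint_family_on_def pair_eq_iff doubleton_eq_iff intro!: pair_in_sources)
    from indep_setsD [OF this, of U Y] have "prob (\<Inter>w\<in>U. Y w) = (\<Prod>w\<in>U. prob (Y w))"
      using U(1) False Yset by auto
    also have "\<dots> = (\<Prod>w\<in>U. 1 - q1 * q2)"
    proof (rule prod.cong [OF refl])
      fix w assume w: "w \<in> U"
      then have wab: "a \<noteq> w" "w \<noteq> b" using U by auto
      have "indep_set (sets (generated_by {pair k a w})) (sets (generated_by {pair k w b}))"
        using wab U(2) by (intro indep_set_generated_by)
          (auto simp: pair_eq_iff doubleton_eq_iff intro!: pair_in_sources)
      then have "prob ({\<omega> \<in> space M. edge k a w \<omega> < q1} \<inter> {\<omega> \<in> space M. edge k w b \<omega> < q2}) = q1 * q2"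
        using wab q by (subst indep_setD) (auto intro!: measurable_edge_set simp: prob_edge_less)
      then show "prob (Y w) = 1 - q1 * q2"
        unfolding Y_def using rv_edge_value [OF wab(1)] rv_edge_value [OF wab(2)]
        by (subst prob_compl) auto
    qed
    finally show ?thesis using False by (simp add: ZY)
  qed (simp add: ZY prob_space)
qed

text \<open>Taking the least index makes the choice of a vertex in the region measurable. In an
  empty region the value is unspecified, so \<open>occupied\<close> has to accompany it.\<close>

definition first_in :: "real \<Rightarrow> ('v \<times> real) set \<Rightarrow> 'w \<Rightarrow> nat" where
  "first_in s S \<omega> = (LEAST i. relative_vertex s \<omega> i \<in> S)"

definition occupied :: "real \<Rightarrow> ('v \<times> real) set \<Rightarrow> 'w \<Rightarrow> bool" where
  "occupied s S \<omega> \<longleftrightarrow> (\<exists>i. relative_vertex s \<omega> i \<in> S)"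

lemma rel_first_in: "occupied s S \<omega> \<Longrightarrow> relative_vertex s \<omega> (first_in s S \<omega>) \<in> S"
  unfolding occupied_def first_in_def by (rule LeastI_ex)

lemma measurable_in_region:
  assumes "0 \<le> s" "S \<in> sets borel"
  shows "Measurable.pred (generated_by vertex_sources) (\<lambda>\<omega>. relative_vertex s \<omega> i \<in> S)"
  using measurable_sets [OF measurable_relative_vertex [OF assms(1)] assms(2), of i]
  by (simp add: pred_def vimage_def Int_def conj_commute)

lemma measurable_first_in:
  assumes "0 \<le> s" "S \<in> sets borel"
  shows "first_in s S \<in> measurable (generated_by vertex_sources) (count_space UNIV)"
  and "Measurable.pred (generated_by vertex_sources) (occupied s S)"
proof -
  note [measurable] = measurable_in_region [OF assms]
  show "first_in s S \<in> measurable (generated_by vertex_sources) (count_space UNIV)"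
    unfolding first_in_def by measurable
  show "Measurable.pred (generated_by vertex_sources) (occupied s S)"
    unfolding occupied_def by measurable
qed

lemma indep_vertices_edges:
  assumes "K \<subseteq> {pair k i j | k i j. i \<noteq> j}"
  shows "indep_set (sets (generated_by vertex_sources)) (sets (generated_by K))"
proof (rule indep_set_generated_by)
  show "K \<subseteq> sources" using assms pair_in_sources by auto
  show "vertex_sources \<inter> K = {}" using assms by (auto simp: vertex_sources_def pair_def)
qed (rule vertex_sources_subset)

text \<open>
  Given the vertices, each connector \<open>w\<close> fails independently with probability \<open>1 - q1 * q2\<close>; the
  expectation of the resulting product is the Laplace functional of the connectors.
\<close>
lemma outer_measure_no_link:
  fixes k :: nat
  assumes k: "0 < k" and C: "C \<in> sets borel" "emeasure lborel C = ennreal m" "0 \<le> m"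
    and ab: "0 \<le> a" "a \<le> b" "b \<le> 1"
    and S: "S1 \<in> sets borel" "S2 \<in> sets borel" "S1 \<inter> C \<times> {a<..<b} = {}" "S2 \<inter> C \<times> {a<..<b} = {}"
    and q: "0 \<le> q1" "q1 \<le> 1" "0 \<le> q2" "q2 \<le> 1"
  shows "outer_measure_of M {\<omega> \<in> space M. occupied k S1 \<omega> \<and> occupied k S2 \<omega> \<and> first_in k S1 \<omega> \<noteq> first_in k S2 \<omega> \<and>
      (\<forall>w. relative_vertex k \<omega> w \<in> C \<times> {a<..<b} \<longrightarrow>
        \<not> (edge k (Suc (first_in k S1 \<omega>)) (Suc w) \<omega> < q1 \<and> edge k (Suc w) (Suc (first_in k S2 \<omega>)) \<omega> < q2))}
    \<le> ennreal (exp (- (q1 * q2 * lam * m * (b - a))))" (is "outer_measure_of M ?F \<le> _")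
proof -
  define T where "T = C \<times> {a<..<b}"
  have T: "T \<in> sets borel" using C by (auto simp: T_def borel_Times)
  note [measurable] = measurable_first_in [OF of_nat_0_le_iff S(1), of k] measurable_first_in [OF of_nat_0_le_iff S(2), of k]
    measurable_in_region [OF of_nat_0_le_iff T, of k]
  define h where "h = q1 * q2"
  have h: "0 \<le> h" "h \<le> 1" using q by (auto simp: h_def mult_le_one)
  \<comment> \<open>Only connectors among the first \<open>n\<close> points are used, which leaves
    countably many configurations \<open>D\<close>; the infimum over \<open>n\<close> is taken at
    the end.\<close>
  have "outer_measure_of M ?F \<le> (\<integral>\<^sup>+\<omega>. (\<Prod>i<n. ennreal (1 - h * indicator T (relative_vertex k \<omega> i))) \<partial>M)" for n
  proof -
    define Q where "Q \<omega> \<longleftrightarrow> occupied k S1 \<omega> \<and> occupied k S2 \<omega> \<and> first_in k S1 \<omega> \<noteq> first_in k S2 \<omega>" for \<omega>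
    define D where "D \<omega> = (first_in k S1 \<omega>, first_in k S2 \<omega>, {w\<in>{..<n}. relative_vertex k \<omega> w \<in> T})" for \<omega>
    define V where "V = {(x, y, U). x \<noteq> y \<and> U \<subseteq> {..<n} \<and> x \<notin> U \<and> y \<notin> U}"
    define Z where "Z = (\<lambda>(x, y, U). {\<omega> \<in> space M. \<forall>w\<in>Suc ` U. \<not> (edge k (Suc x) w \<omega> < q1 \<and> edge k w (Suc y) \<omega> < q2)})"
    define f where "f = (\<lambda>(x :: nat, y :: nat, U :: nat set). (1 - h) ^ card U)"
    define K where "K = {pair k i j | k i j. i \<noteq> j}"
    \<comment> \<open>The regions \<open>S1\<close> and \<open>S2\<close> avoid the connector
      region, so neither star is among the connectors and \<open>prob_no_path\<close> will
      apply.\<close>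
    have DV: "D \<omega> \<in> V" if "Q \<omega>" for \<omega>
      using that S(3,4) rel_first_in [of k S1 \<omega>] rel_first_in [of k S2 \<omega>] by (auto simp: D_def V_def Q_def T_def)
    have Fsub: "?F \<subseteq> {\<omega> \<in> space M. Q \<omega> \<and> D \<omega> \<in> V \<and> \<omega> \<in> Z (D \<omega>)}"
      using DV by (auto simp: D_def Z_def Q_def T_def)
    have Vc: "countable V"
    proof (rule countable_subset)
      show "V \<subseteq> UNIV \<times> UNIV \<times> Pow {..<n}" by (auto simp: V_def)
      show "countable (UNIV \<times> UNIV \<times> Pow {..<n} :: (nat \<times> nat \<times> nat set) set)"
        by (intro countable_SIGMA) (auto intro: countable_finite)
    qed
    have Dm: "{\<omega> \<in> space M. Q \<omega> \<and> D \<omega> = d} \<in> sets (generated_by vertex_sources)" for d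
    proof -
      obtain x y U where d: "d = (x, y, U)" by (cases d)
      have [measurable]: "Measurable.pred (generated_by vertex_sources) (\<lambda>\<omega>. w < n \<and> relative_vertex k \<omega> w \<in> T \<longleftrightarrow> w \<in> U)" for w
        by (cases "w \<in> U") simp_all
      have "{\<omega> \<in> space M. Q \<omega> \<and> D \<omega> = d} = {\<omega> \<in> space (generated_by vertex_sources).
         Q \<omega> \<and> first_in k S1 \<omega> = x \<and> first_in k S2 \<omega> = y \<and> (\<forall>w. w < n \<and> relative_vertex k \<omega> w \<in> T \<longleftrightarrow> w \<in> U)}"
        by (auto simp: d D_def)
      also have "\<dots> \<in> sets (generated_by vertex_sources)"
      proof -
        have [measurable]: "Measurable.pred (generated_by vertex_sources) (\<lambda>\<omega>. \<forall>w. (w < n \<and> relative_vertex k \<omega> w \<in> T) = (w \<in> U))"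
          by (rule pred_intros_countable) measurable
        have [measurable]: "Measurable.pred (generated_by vertex_sources) Q"
        proof -
          \<comment> \<open>Inequality of the two stars is rewritten as a countable quantification
            over a common value, which is visibly measurable.\<close>
          have "Q = (\<lambda>\<omega>. occupied k S1 \<omega> \<and> occupied k S2 \<omega> \<and> \<not> (\<exists>i. first_in k S1 \<omega> = i \<and> first_in k S2 \<omega> = i))"
            by (auto simp: Q_def fun_eq_iff)
          moreover have "Measurable.pred (generated_by vertex_sources) \<dots>" by measurable
          ultimately show ?thesis by (simp only:)
        qed
        show ?thesis by measurable
      qed
      finally show ?thesis .
    qed
    have Zm: "Z d \<in> sets (generated_by K)" "prob (Z d) = f d" if "d \<in> V" for d
    proof -
      obtain x y U where d: "d = (x, y, U)" by (cases d)
      have U: "finite (Suc ` U)" "Suc x \<noteq> Suc y" "Suc x \<notin> Suc ` U" "Suc y \<notin> Suc ` U"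
        using that by (auto simp: d V_def intro: finite_subset)
      have K': "(\<Union>w\<in>Suc ` U. {pair k (Suc x) w, pair k w (Suc y)}) \<subseteq> K"
      proof (rule UN_least)
        fix w assume "w \<in> Suc ` U"
        then have "Suc x \<noteq> w" "w \<noteq> Suc y" using U by metis+
        then show "{pair k (Suc x) w, pair k w (Suc y)} \<subseteq> K" by (simp add: K_def) blast
      qed
      show "Z d \<in> sets (generated_by K)"
        using prob_no_path(1) [OF U q, of k] sets_generated_by_mono [OF K'] by (auto simp: Z_def d)
      show "prob (Z d) = f d"
        using prob_no_path(2) [OF U q, of k] by (simp add: Z_def d f_def h_def card_image)
    qed
    have sub: "sets (generated_by vertex_sources) \<subseteq> sets M" "sets (generated_by K) \<subseteq> sets M"
      using vertex_sources_subset pair_in_sources by (auto intro!: sets_generated_by_subset simp: K_def)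
    have "{\<omega> \<in> space M. Q \<omega> \<and> D \<omega> \<in> V \<and> \<omega> \<in> Z (D \<omega>)} = (\<Union>d\<in>V. {\<omega> \<in> space M. Q \<omega> \<and> D \<omega> = d} \<inter> Z d)"
      by auto
    also have "\<dots> \<in> sets M"
      using sub Dm Zm(1) Vc by (intro sets.countable_UN'' sets.Int) auto
    finally have "{\<omega> \<in> space M. Q \<omega> \<and> D \<omega> \<in> V \<and> \<omega> \<in> Z (D \<omega>)} \<in> sets M" .
    with Fsub have "outer_measure_of M ?F \<le> emeasure M {\<omega> \<in> space M. Q \<omega> \<and> D \<omega> \<in> V \<and> \<omega> \<in> Z (D \<omega>)}"
      by (rule outer_measure_of_le)
    also have "\<dots> \<le> (\<integral>\<^sup>+\<omega>. ennreal (f (D \<omega>)) * indicator {\<omega>. Q \<omega> \<and> D \<omega> \<in> V} \<omega> \<partial>M)"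
      using Dm Zm Vc h by (intro emeasure_freeze_countable [OF indep_vertices_edges [of K]])
        (auto simp: f_def K_def)
    also have "\<dots> \<le> (\<integral>\<^sup>+\<omega>. (\<Prod>i<n. ennreal (1 - h * indicator T (relative_vertex k \<omega> i))) \<partial>M)"
    proof (rule nn_integral_mono)
      fix \<omega>
      \<comment> \<open>Each factor is \<open>1 - h\<close> at a connector and 1 elsewhere, so the
        product is exactly the failure probability \<open>f (D \<omega>)\<close>.\<close>
      have "(\<Prod>i<n. ennreal (1 - h * indicator T (relative_vertex k \<omega> i))) = (\<Prod>i<n. if relative_vertex k \<omega> i \<in> T then ennreal (1 - h) else 1)"
        by (intro prod.cong) auto
      also have "\<dots> = ennreal (1 - h) ^ card {w\<in>{..<n}. relative_vertex k \<omega> w \<in> T}"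
        by (subst prod.If_cases) (auto simp: Int_def)
      also have "\<dots> = ennreal (f (D \<omega>))"
        using h by (simp add: f_def D_def ennreal_power)
      finally show "ennreal (f (D \<omega>)) * indicator {\<omega>. Q \<omega> \<and> D \<omega> \<in> V} \<omega>
          \<le> (\<Prod>i<n. ennreal (1 - h * indicator T (relative_vertex k \<omega> i)))"
        by (auto simp: indicator_def)
    qed
    finally show ?thesis .
  qed
  then have "outer_measure_of M ?F \<le> (INF n. \<integral>\<^sup>+\<omega>. (\<Prod>i<n. ennreal (1 - h * indicator T (relative_vertex k \<omega> i))) \<partial>M)"
    by (intro INF_greatest)
  also have "\<dots> \<le> ennreal (exp (- (h * lam * m * (b - a))))"
    unfolding T_def using k by (intro moved_points_laplace C ab h) auto
  finally show ?thesis by (simp add: h_def)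
qed

text \<open>The void probability of the Poisson process, obtained from the Laplace functional with
  \<open>h = 1\<close>: the partial products equal 1 when the region is empty.\<close>

lemma outer_measure_not_occupied:
  fixes k :: nat
  assumes k: "0 < k" and C: "C \<in> sets borel" "emeasure lborel C = ennreal m" "0 \<le> m"
    and ab: "0 \<le> a" "a \<le> b" "b \<le> 1"
  shows "outer_measure_of M {\<omega> \<in> space M. \<not> occupied k (C \<times> {a<..<b}) \<omega>} \<le> ennreal (exp (- (lam * m * (b - a))))"
proof -
  define T where "T = C \<times> {a<..<b}"
  have T: "T \<in> sets borel" using C by (auto simp: T_def borel_Times)
  have "Measurable.pred M (occupied k T)"
    using measurable_first_in(2) [OF _ T] vertex_sources_subset by (rule measurable_generated_byD) simp
  then have F: "{\<omega> \<in> space M. \<not> occupied k T \<omega>} \<in> sets M" by measurable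
  have "emeasure M {\<omega> \<in> space M. \<not> occupied k T \<omega>} \<le> (\<integral>\<^sup>+\<omega>. (\<Prod>i<n. ennreal (1 - 1 * indicator T (relative_vertex k \<omega> i))) \<partial>M)" for n
  proof -
    have "emeasure M {\<omega> \<in> space M. \<not> occupied k T \<omega>} = (\<integral>\<^sup>+\<omega>. indicator {\<omega> \<in> space M. \<not> occupied k T \<omega>} \<omega> \<partial>M)"
      using F by simp
    also have "\<dots> \<le> (\<integral>\<^sup>+\<omega>. (\<Prod>i<n. ennreal (1 - 1 * indicator T (relative_vertex k \<omega> i))) \<partial>M)"
      by (intro nn_integral_mono) (auto simp: indicator_def occupied_def)
    finally show ?thesis .
  qed
  then have "outer_measure_of M {\<omega> \<in> space M. \<not> occupied k T \<omega>}
      \<le> (INF n. \<integral>\<^sup>+\<omega>. (\<Prod>i<n. ennreal (1 - 1 * indicator T (relative_vertex k \<omega> i))) \<partial>M)"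
    using F by (simp add: INF_greatest)
  also have "\<dots> \<le> ennreal (exp (- (1 * lam * m * (b - a))))"
    unfolding T_def using k by (intro moved_points_laplace C ab) auto
  finally show ?thesis by (simp add: T_def)
qed

text \<open>The edge variables of different integer times are different sources. Once the stars are
  fixed, the \<open>N\<close> attempts are therefore independent, although the stars at different
  times may depend on each other.\<close>

lemma outer_measure_origin_never_linked:
  assumes S: "S \<in> sets borel" and q: "0 \<le> q" "q \<le> 1"
  shows "outer_measure_of M {\<omega> \<in> space M. \<forall>k\<in>{1..N}. occupied (real k) S \<omega> \<and> \<not> edge k 0 (Suc (first_in (real k) S \<omega>)) \<omega> < q}
    \<le> ennreal ((1 - q) ^ N)" (is "outer_measure_of M ?F \<le> _")
proof -
  note [measurable] = measurable_first_in [OF of_nat_0_le_iff S]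
  \<comment> \<open>Restricting to the finite set of times makes the record of all stars a variable
    with countably many values.\<close>
  define D where "D \<omega> = (\<lambda>k\<in>{1..N}. first_in (real k) S \<omega>)" for \<omega>
  define V where "V = (PiE {1..N} (\<lambda>_. UNIV) :: (nat \<Rightarrow> nat) set)"
  define Z where "Z d = {\<omega> \<in> space M. \<forall>k\<in>{1..N}. \<not> edge k 0 (Suc (d k)) \<omega> < q}" for d
  define K where "K = {pair k i j | k i j. i \<noteq> j}"
  have Vc: "countable V" unfolding V_def by (intro countable_PiE) auto
  have Dm: "{\<omega> \<in> space M. True \<and> D \<omega> = d} \<in> sets (generated_by vertex_sources)" if "d \<in> V" for d
  proof -
    have "{\<omega> \<in> space M. True \<and> D \<omega> = d} = {\<omega> \<in> space (generated_by vertex_sources). \<forall>k\<in>{1..N}. first_in (real k) S \<omega> = d k}"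
      using that by (auto simp: D_def V_def PiE_def extensional_def fun_eq_iff restrict_def)
    also have "\<dots> \<in> sets (generated_by vertex_sources)" by measurable
    finally show ?thesis .
  qed
  have Zm: "Z d \<in> sets (generated_by K)" "prob (Z d) = (1 - q) ^ N" for d
  proof -
    define Y where "Y k = space M - {\<omega> \<in> space M. edge k 0 (Suc (d k)) \<omega> < q}" for k
    have Yset: "Y k \<in> sets (generated_by K')" if "pair k 0 (Suc (d k)) \<in> K'" for k K'
      unfolding Y_def using that sets.top [of "generated_by K'"]
      by (auto intro!: sets.Diff measurable_edge_set)
    have ZY: "Z d = (if N = 0 then space M else (\<Inter>k\<in>{1..N}. Y k))"
      by (auto simp: Z_def Y_def)
    show "Z d \<in> sets (generated_by K)"
      unfolding ZY using sets.top [of "generated_by K"]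
      by (auto intro!: sets.finite_INT Yset simp: K_def simp del: sets.top)
    have "prob (\<Inter>k\<in>{1..N}. Y k) = (1 - q) ^ N" if "0 < N"
    proof -
      have "indep_sets (\<lambda>k. sets (generated_by {pair k 0 (Suc (d k))})) {1..N}"
        by (intro indep_sets_generated_by)
          (auto simp: disjoint_family_on_def pair_eq_iff intro!: pair_in_sources)
      then have "prob (\<Inter>k\<in>{1..N}. Y k) = (\<Prod>k\<in>{1..N}. prob (Y k))"
        using that by (intro indep_setsD) (auto intro!: Yset)
      also have "\<dots> = (\<Prod>k\<in>{1..N}. 1 - q)"
        unfolding Y_def using rv_edge_value q by (intro prod.cong refl) (subst prob_compl, auto simp: prob_edge_less)
      finally show ?thesis by simp
    qed
    then show "prob (Z d) = (1 - q) ^ N" by (simp add: ZY prob_space)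
  qed
  have sub: "sets (generated_by vertex_sources) \<subseteq> sets M" "sets (generated_by K) \<subseteq> sets M"
    using vertex_sources_subset pair_in_sources by (auto intro!: sets_generated_by_subset simp: K_def)
  have "{\<omega> \<in> space M. True \<and> D \<omega> \<in> V \<and> \<omega> \<in> Z (D \<omega>)} = (\<Union>d\<in>V. {\<omega> \<in> space M. True \<and> D \<omega> = d} \<inter> Z d)"
    by auto
  also have "\<dots> \<in> sets M"
    using sub Dm Zm(1) Vc by (intro sets.countable_UN'' sets.Int) auto
  finally have "{\<omega> \<in> space M. True \<and> D \<omega> \<in> V \<and> \<omega> \<in> Z (D \<omega>)} \<in> sets M" .
  moreover have "?F \<subseteq> {\<omega> \<in> space M. True \<and> D \<omega> \<in> V \<and> \<omega> \<in> Z (D \<omega>)}"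
    by (auto simp: D_def V_def Z_def)
  ultimately have "outer_measure_of M ?F \<le> emeasure M {\<omega> \<in> space M. True \<and> D \<omega> \<in> V \<and> \<omega> \<in> Z (D \<omega>)}"
    by (intro outer_measure_of_le)
  also have "\<dots> \<le> (\<integral>\<^sup>+\<omega>. ennreal ((1 - q) ^ N) * indicator {\<omega>. True \<and> D \<omega> \<in> V} \<omega> \<partial>M)"
    using Dm Zm Vc q by (intro emeasure_freeze_countable [OF indep_vertices_edges [of K]])
      (auto simp: K_def)
  also have "\<dots> \<le> (\<integral>\<^sup>+\<omega>. ennreal ((1 - q) ^ N) \<partial>M)"
    by (intro nn_integral_mono) (auto simp: indicator_def)
  finally show ?thesis by (simp add: emeasure_space_1)
qed

end

section \<open>Infinite chains and the connection bound\<close>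

lemma outer_measure_of_UN_le:
  "outer_measure_of M (\<Union>i. A i) \<le> (\<Sum>i::nat. outer_measure_of M (A i))"
  if "\<And>i. A i \<subseteq> space M"
proof -
  \<comment> \<open>Every set is replaced by a measurable superset of the same outer measure, where
    countable subadditivity is available.\<close>
  have "\<exists>E. \<forall>i. E i \<in> sets M \<and> A i \<subseteq> E i \<and> outer_measure_of M (A i) = emeasure M (E i)"
    using outer_measure_of_attain [OF that] by (intro choice) blast
  then obtain E where E: "\<And>i. E i \<in> sets M" "\<And>i. A i \<subseteq> E i" "\<And>i. outer_measure_of M (A i) = emeasure M (E i)"
    by blast
  have "outer_measure_of M (\<Union>i. A i) \<le> emeasure M (\<Union>i. E i)"
    using E by (intro outer_measure_of_le) auto
  also have "\<dots> \<le> (\<Sum>i. emeasure M (E i))"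
    using E by (intro emeasure_subadditive_countably) auto
  finally show ?thesis by (simp add: E)
qed

lemma outer_measure_of_Un_le:
  assumes "A \<subseteq> space M" "B \<subseteq> space M"
  shows "outer_measure_of M (A \<union> B) \<le> outer_measure_of M A + outer_measure_of M B"
proof -
  obtain E where E: "E \<in> sets M" "A \<subseteq> E" "outer_measure_of M A = emeasure M E"
    using outer_measure_of_attain [OF assms(1)] by blast
  obtain F where F: "F \<in> sets M" "B \<subseteq> F" "outer_measure_of M B = emeasure M F"
    using outer_measure_of_attain [OF assms(2)] by blast
  have "outer_measure_of M (A \<union> B) \<le> emeasure M (E \<union> F)"
    using E F by (intro outer_measure_of_le) auto
  also have "\<dots> \<le> emeasure M E + emeasure M F"
    using E F by (intro emeasure_subadditive) auto
  finally show ?thesis by (simp add: E F)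
qed

lemma outer_measure_of_finite_UN_le:
  assumes "finite I" "\<And>i. i \<in> I \<Longrightarrow> A i \<subseteq> space M"
  shows "outer_measure_of M (\<Union>i\<in>I. A i) \<le> (\<Sum>i\<in>I. outer_measure_of M (A i))"
  using assms
proof (induction I)
  case (insert i I)
  have "outer_measure_of M (A i \<union> (\<Union>i\<in>I. A i)) \<le> outer_measure_of M (A i) + outer_measure_of M (\<Union>i\<in>I. A i)"
    using insert.prems by (intro outer_measure_of_Un_le) auto
  also have "\<dots> \<le> outer_measure_of M (A i) + (\<Sum>i\<in>I. outer_measure_of M (A i))"
    using insert.IH insert.prems by (intro add_left_mono) auto
  finally show ?case using insert.hyps by simp
qed simp

text \<open>\<open>infinite_component\<close> is the union of all infinite components, so it is
  enough that infinitely many vertices can be reached from \<open>f 0\<close>.\<close>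

lemma chain_in_infinite_component:
  assumes "\<And>n. adj\<^sup>*\<^sup>* (f n) (f (Suc n))" "infinite (range f)"
  shows "f 0 \<in> infinite_component adj"
proof -
  have reach: "adj\<^sup>*\<^sup>* (f 0) (f n)" for n
    by (induction n) (auto intro: rtranclp_trans assms)
  define C where "C = {j. adj\<^sup>*\<^sup>* (f 0) j}"
  have "C = {(i, j). adj\<^sup>*\<^sup>* i j} `` {f 0}" by (auto simp: C_def)
  then have "C \<in> components adj" unfolding components_def by (metis UNIV_I quotientI)
  moreover have "range f \<subseteq> C" using reach by (auto simp: C_def)
  with assms(2) have "infinite C" using finite_subset by blast
  ultimately show ?thesis unfolding infinite_component_def C_def by blast
qed

text \<open>Finitely many positive values have a positive minimum, which a null sequence of upper
  bounds eventually undercuts. The values will be the marks of the stars.\<close>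

lemma infinite_range_of_vanishing:
  fixes g :: "'b \<Rightarrow> real"
  assumes "\<And>n. 0 < g (f n)" "\<And>n. g (f n) < v n" "v \<longlonglongrightarrow> 0"
  shows "infinite (range f)"
proof
  assume fin: "finite (range f)"
  define e where "e = Min (g ` range f)"
  have "0 < e" unfolding e_def using fin assms(1) by (subst Min_gr_iff) auto
  then have "\<forall>\<^sub>F n in sequentially. v n < e"
    using order_tendstoD(2) [OF assms(3)] by blast
  then obtain n where "v n < e" using eventually_happens by force
  moreover have "e \<le> g (f n)" unfolding e_def using fin by (intro Min_le) auto
  ultimately show False using assms(2) [of n] by simp
qed

text \<open>The mark contributes at least \<open>z powr (\<delta> * \<gamma>)\<close> and the
  distance at least a constant times \<open>z powr (- (\<delta> * a))\<close>. The case
  \<open>a = \<gamma>\<close> gives a bound of order one between a star and nearby connectors, the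
  case \<open>a = 1 + \<eta>\<close> the bound of order \<open>z powr (- e)\<close> across the cube
  of stars.\<close>

lemma connection_lower_bound_ge:
  fixes x y :: "'v::euclidean_space \<times> real"
  assumes xy: "x \<in> vertex_space" "y \<in> vertex_space" "min (snd x) (snd y) \<le> 1 / z" "1 \<le> z"
    and dist: "norm (fst x - fst y) \<le> s * z powr (a / real DIM('v))" "0 < s" "\<gamma> \<le> a"
    and par: "0 < \<alpha>" "0 < \<kappa>" "0 < \<gamma>" "0 < \<delta>"
  shows "\<alpha> * min 1 (\<kappa> * s powr (- (\<delta> * real DIM('v)))) * z powr (- (\<delta> * (a - \<gamma>)))
    \<le> connection_lower_bound \<alpha> \<kappa> \<gamma> \<delta> x y"
proof -
  define d where "d = real DIM('v)"
  have d: "0 < d" by (simp add: d_def)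
  define c where "c = \<kappa> * s powr (- (\<delta> * d))"
  define \<zeta> where "\<zeta> = z powr (- (\<delta> * (a - \<gamma>)))"
  have "0 \<le> \<delta> * (a - \<gamma>)" using dist par by simp
  then have \<zeta>: "0 < \<zeta>" "\<zeta> \<le> 1"
    using xy(4) powr_mono [of "- (\<delta> * (a - \<gamma>))" 0 z] by (auto simp: \<zeta>_def)
  \<comment> \<open>Because \<open>\<gamma> \<le> a\<close>, the power \<open>\<zeta>\<close> is at
    most 1, so the bound survives the minimum with 1.\<close>
  have le: "min 1 c * \<zeta> \<le> 1" using \<zeta> by (auto simp: min_def intro: mult_le_one)
  show ?thesis
  proof (cases "fst x = fst y")
    case True
    then show ?thesis using par le unfolding c_def \<zeta>_def d_def
      by (simp add: connection_lower_bound_def mult_le_cancel_left1 mult.assoc)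
  next
    case False
    define u where "u = min (snd x) (snd y)"
    define r where "r = norm (fst x - fst y)"
    have u: "0 < u" "u \<le> 1 / z" using xy by (auto simp: u_def vertex_space_def)
    have r: "0 < r" "r \<le> s * z powr (a / d)" using False dist by (auto simp: r_def d_def)
    have "z powr (\<delta> * \<gamma>) \<le> (1 / u) powr (\<delta> * \<gamma>)"
      using u xy(4) par by (intro powr_mono2) (auto simp: field_simps)
    also have "\<dots> = u powr (- (\<delta> * \<gamma>))"
      using u by (simp add: powr_minus_divide powr_divide)
    finally have 1: "z powr (\<delta> * \<gamma>) \<le> u powr (- (\<delta> * \<gamma>))" .
    have 2: "(s * z powr (a / d)) powr (- (\<delta> * d)) \<le> r powr (- (\<delta> * d))"
      using r d par by (intro powr_mono2') auto
    have "(s * z powr (a / d)) powr (- (\<delta> * d)) = s powr (- (\<delta> * d)) * z powr (- (\<delta> * a))"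
      using dist xy(4) d by (simp add: powr_mult powr_powr mult.commute)
    then have "c * \<zeta> = \<kappa> * z powr (\<delta> * \<gamma>) * (s * z powr (a / d)) powr (- (\<delta> * d))"
      by (simp add: c_def \<zeta>_def powr_add [symmetric] algebra_simps)
    also have "\<dots> \<le> \<kappa> * u powr (- (\<delta> * \<gamma>)) * r powr (- (\<delta> * d))"
      using 1 2 par by (intro mult_mono) auto
    finally have "c * \<zeta> \<le> \<kappa> * u powr (- (\<delta> * \<gamma>)) * r powr (- (\<delta> * d))" .
    moreover have "min 1 c * \<zeta> \<le> c * \<zeta>" using \<zeta> by (intro mult_right_mono) auto
    ultimately have "min 1 c * \<zeta> \<le> min 1 (\<kappa> * u powr (- (\<delta> * \<gamma>)) * r powr (- (\<delta> * d)))"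
      using le by simp
    from mult_left_mono [OF this, of \<alpha>] show ?thesis
      using False par unfolding connection_lower_bound_def u_def r_def c_def \<zeta>_def d_def
      by (simp add: mult.assoc)
  qed
qed

section \<open>Moved vertices and an upper bound for the percolation time\<close>

context mobile_graph
begin

lemma mobile_adjacent_iff:
  "mobile_adjacent p U0 P B E (real k) \<omega> i j \<longleftrightarrow>
    i \<noteq> j \<and> edge k i j \<omega> < p (vertex_at U0 P B k \<omega> i) (vertex_at U0 P B k \<omega> j)"
  by (simp add: mobile_adjacent_def adjacent_def edge_def)

lemma vertex_at_0: "vertex_at U0 P B s \<omega> 0 = (B 0 s \<omega>, U0 \<omega>)"
  by (simp add: vertex_at_def)

lemma vertex_at_Suc: "vertex_at U0 P B s \<omega> (Suc i) = (fst (P i \<omega>) + B (Suc i) s \<omega>, snd (P i \<omega>))"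
  by (simp add: vertex_at_def split_beta)

lemma vertex_at_relative_vertex:
  "fst (vertex_at U0 P B s \<omega> (Suc i)) = fst (relative_vertex s \<omega> i) + B 0 s \<omega>"
  "snd (vertex_at U0 P B s \<omega> (Suc i)) = snd (relative_vertex s \<omega> i)"
  by (simp_all add: vertex_at_Suc relative_vertex_def)

lemma snd_relative_vertex: "snd (relative_vertex s \<omega> i) = snd (P i \<omega>)"
  by (simp add: relative_vertex_def)

lemma vertex_at_in_vertex_space: "\<omega> \<in> space M \<Longrightarrow> vertex_at U0 P B s \<omega> (Suc i) \<in> vertex_space"
  using point_in_vertex_space [of \<omega> i] by (auto simp: vertex_at_Suc vertex_space_def)

text \<open>\<open>J n\<close> will be the first star of the scale with number \<open>n\<close>;
  vanishing marks force infinitely many different stars. Consecutive stars may coincide, and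
  otherwise two edges through a connector \<open>w\<close> join them, so \<open>J 0\<close> gives a
  vertex of an infinite component next to the origin vertex.\<close>

lemma percolation_time_le:
  assumes \<omega>: "\<omega> \<in> space M"
    and mark: "\<And>n. snd (P (J n) \<omega>) < v n" "v \<longlonglongrightarrow> 0"
    and link: "\<And>n. J n = J (Suc n) \<or> (\<exists>w. mobile_adjacent p U0 P B E (real k) \<omega> (Suc (J n)) w
        \<and> mobile_adjacent p U0 P B E (real k) \<omega> w (Suc (J (Suc n))))"
    and origin: "mobile_adjacent p U0 P B E (real k) \<omega> (Suc (J 0)) 0"
  shows "percolation_time p U0 P B E \<omega> \<le> ereal (real k)"
proof -
  let ?adj = "mobile_adjacent p U0 P B E (real k) \<omega>"
  have "infinite (range J)"
    using mark point_in_vertex_space [OF \<omega>]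
    by (intro infinite_range_of_vanishing [of "\<lambda>i. snd (P i \<omega>)" J v]) (auto simp: vertex_space_def mem_Times_iff)
  then have "infinite (range (\<lambda>n. Suc (J n)))"
    using finite_imageD [of Suc "range J"] by (auto simp: image_image)
  moreover have "?adj\<^sup>*\<^sup>* (Suc (J n)) (Suc (J (Suc n)))" for n
  proof (cases "J n = J (Suc n)")
    case False
    with link [of n] obtain w where "?adj (Suc (J n)) w" "?adj w (Suc (J (Suc n)))" by blast
    then show ?thesis by (meson converse_rtranclp_into_rtranclp r_into_rtranclp)
  qed simp
  ultimately have "Suc (J 0) \<in> infinite_component ?adj"
    using chain_in_infinite_component [of ?adj "\<lambda>n. Suc (J n)"] by blast
  with origin show ?thesis
    unfolding percolation_time_def by (intro Inf_lower) (auto intro!: imageI)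
qed

end

section \<open>Links between consecutive scales\<close>

definition cube :: "real \<Rightarrow> 'v::euclidean_space set" where
  "cube R = box (- (R *\<^sub>R One)) (R *\<^sub>R One)"

lemma mem_cube: "x \<in> cube R \<longleftrightarrow> (\<forall>b\<in>Basis. \<bar>x \<bullet> b\<bar> < R)"
  by (auto simp: cube_def mem_box abs_less_iff)

lemma cube_borel [measurable]: "cube R \<in> sets borel"
  by (simp add: cube_def)

lemma emeasure_cube: "0 \<le> R \<Longrightarrow> emeasure lborel (cube R :: 'v::euclidean_space set) = ennreal ((2 * R) ^ DIM('v))"
  unfolding cube_def by (subst emeasure_lborel_box) (auto simp: inner_simps)

lemma norm_le_DIM:
  fixes x :: "'v::euclidean_space"
  assumes "\<And>b. b \<in> Basis \<Longrightarrow> \<bar>x \<bullet> b\<bar> \<le> r"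
  shows "norm x \<le> real DIM('v) * r"
proof -
  have "norm x \<le> (\<Sum>b\<in>Basis. \<bar>x \<bullet> b\<bar>)" by (rule norm_le_l1)
  also have "\<dots> \<le> (\<Sum>b\<in>(Basis :: 'v set). r)" using assms by (intro sum_mono)
  finally show ?thesis by simp
qed

definition star_region :: "real \<Rightarrow> real \<Rightarrow> ('v::euclidean_space \<times> real) set" where
  "star_region R z = cube R \<times> {0<..<1 / z}"

lemma star_region_borel: "star_region R z \<in> sets (borel :: ('v::euclidean_space \<times> real) measure)"
  by (simp add: star_region_def borel_Times)

text \<open>The cells are open because only connectors are sought inside them. A star on a face
  still gets a cell by rounding its coordinates down.\<close>

definition grid_cell :: "real \<Rightarrow> ('v \<Rightarrow> int) \<Rightarrow> 'v::euclidean_space set" where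
  "grid_cell l a = box (\<Sum>b\<in>Basis. (l * a b) *\<^sub>R b) (\<Sum>b\<in>Basis. (l * (a b + 1)) *\<^sub>R b)"

lemma emeasure_grid_cell:
  "0 \<le> l \<Longrightarrow> emeasure lborel (grid_cell l a :: 'v::euclidean_space set) = ennreal (l ^ DIM('v))"
  unfolding grid_cell_def
  by (subst emeasure_lborel_box) (simp_all add: inner_diff_left mult_left_mono right_diff_distrib [symmetric])

context mobile_graph
begin

text \<open>The mark above \<open>1 / 2\<close> keeps the connector distinct from the stars, whose
  marks are below \<open>1 / 2\<close>. The connector is required to be near the first star
  \<open>i\<close>; the factor \<open>real DIM('v)\<close> comes from comparing the norm with
  coordinate distances.\<close>

definition linked :: "nat \<Rightarrow> real \<Rightarrow> real \<Rightarrow> real \<Rightarrow> 'w \<Rightarrow> nat \<Rightarrow> nat \<Rightarrow> bool" where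
  "linked k l q1 q2 \<omega> i j \<longleftrightarrow> (\<exists>w. norm (fst (relative_vertex k \<omega> w) - fst (relative_vertex k \<omega> i)) \<le> real DIM('v) * l \<and> 1 / 2 < snd (relative_vertex k \<omega> w)
     \<and> edge k (Suc i) (Suc w) \<omega> < q1 \<and> edge k (Suc w) (Suc j) \<omega> < q2)"

text \<open>
  The first star has a random position, and the Poisson bound needs a deterministic region: take
  the union over all grid cells that may contain the star and look for connectors in that cell.
\<close>
lemma outer_measure_not_linked:
  fixes z z' l R R' q1 q2 :: real and k K :: nat
  assumes k: "0 < k" and z: "2 \<le> z" "2 \<le> z'" and l: "0 < l" "R \<le> real K * l"
    and q: "0 \<le> q1" "q1 \<le> 1" "0 \<le> q2" "q2 \<le> 1"
  defines "S1 \<equiv> star_region R z" and "S2 \<equiv> star_region R' z'"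
  shows "outer_measure_of M {\<omega> \<in> space M. occupied k S1 \<omega> \<and> occupied k S2 \<omega> \<and>
      first_in k S1 \<omega> \<noteq> first_in k S2 \<omega> \<and> \<not> linked k l q1 q2 \<omega> (first_in k S1 \<omega>) (first_in k S2 \<omega>)}
    \<le> ennreal ((2 * real K) ^ DIM('v) * exp (- (q1 * q2 * lam * l ^ DIM('v) / 2)))" (is "outer_measure_of M ?F \<le> _")
proof -
  \<comment> \<open>These are the cells of side \<open>l\<close> that can be assigned to a star in
    the cube, since \<open>R \<le> real K * l\<close>.\<close>
  define I where "I = (PiE Basis (\<lambda>_. {- int K..<int K}) :: ('v \<Rightarrow> int) set)"
  define F where "F a = {\<omega> \<in> space M. occupied k S1 \<omega> \<and> occupied k S2 \<omega> \<and> first_in k S1 \<omega> \<noteq> first_in k S2 \<omega> \<and>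
      (\<forall>w. relative_vertex k \<omega> w \<in> grid_cell l a \<times> {1 / 2<..<1} \<longrightarrow>
        \<not> (edge k (Suc (first_in k S1 \<omega>)) (Suc w) \<omega> < q1 \<and> edge k (Suc w) (Suc (first_in k S2 \<omega>)) \<omega> < q2))}" for a
  have I: "finite I" "real (card I) = (2 * real K) ^ DIM('v)"
    unfolding I_def by (auto intro!: finite_PiE simp: card_PiE)
  have "?F \<subseteq> (\<Union>a\<in>I. F a)"
  proof
    fix \<omega> assume \<omega>: "\<omega> \<in> ?F"
    define x where "x = fst (relative_vertex k \<omega> (first_in k S1 \<omega>))"
    define a where "a = (\<lambda>b\<in>(Basis :: 'v set). \<lfloor>x \<bullet> b / l\<rfloor>)"
    have "relative_vertex k \<omega> (first_in k S1 \<omega>) \<in> S1" using \<omega> by (auto intro: rel_first_in)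
    then have x: "\<bar>x \<bullet> b\<bar> < R" if "b \<in> Basis" for b
      using that by (auto simp: S1_def star_region_def x_def mem_cube mem_Times_iff)
    have "a \<in> I"
      unfolding I_def
    proof (rule PiE_I)
      fix b :: 'v assume b: "b \<in> Basis"
      have "\<bar>x \<bullet> b\<bar> < real K * l" using x [OF b] l(2) by linarith
      then have "\<bar>x \<bullet> b / l\<bar> < real K"
        using l(1) by (simp add: abs_divide field_simps)
      then have "- real K < x \<bullet> b / l" "x \<bullet> b / l < real K" unfolding abs_less_iff by linarith+
      then have "- int K \<le> \<lfloor>x \<bullet> b / l\<rfloor>" "\<lfloor>x \<bullet> b / l\<rfloor> < int K"
        by (auto simp: le_floor_iff floor_less_iff)
      then show "a b \<in> {- int K..<int K}" using b by (simp add: a_def)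
    qed (simp add: a_def)
    moreover have "\<omega> \<in> F a"
      unfolding F_def
    proof (intro CollectI conjI allI impI notI)
      show "\<omega> \<in> space M" "occupied k S1 \<omega>" "occupied k S2 \<omega>" using \<omega> by auto
      show False if "first_in k S1 \<omega> = first_in k S2 \<omega>" using \<omega> that by auto
      fix w assume w: "relative_vertex k \<omega> w \<in> grid_cell l a \<times> {1 / 2<..<1}"
        and e: "edge k (Suc (first_in k S1 \<omega>)) (Suc w) \<omega> < q1 \<and> edge k (Suc w) (Suc (first_in k S2 \<omega>)) \<omega> < q2"
      have "norm (fst (relative_vertex k \<omega> w) - x) \<le> real DIM('v) * l"
      proof (rule norm_le_DIM)
        fix b :: 'v assume b: "b \<in> Basis"
        define y where "y = fst (relative_vertex k \<omega> w) \<bullet> b"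
        have y: "l * \<lfloor>x \<bullet> b / l\<rfloor> < y" "y < l * (\<lfloor>x \<bullet> b / l\<rfloor> + 1)"
          using w b by (auto simp: mem_Times_iff grid_cell_def mem_box a_def y_def)
        have "l * \<lfloor>x \<bullet> b / l\<rfloor> \<le> l * (x \<bullet> b / l)" "l * (x \<bullet> b / l) \<le> l * (\<lfloor>x \<bullet> b / l\<rfloor> + 1)"
          using l(1) by (intro mult_left_mono; linarith)+
        then show "\<bar>(fst (relative_vertex k \<omega> w) - x) \<bullet> b\<bar> \<le> l"
          using y l(1) by (simp add: inner_diff_left y_def [symmetric] algebra_simps)
      qed
      then have "linked k l q1 q2 \<omega> (first_in k S1 \<omega>) (first_in k S2 \<omega>)"
        unfolding linked_def x_def using w e by (auto simp: mem_Times_iff)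
      then show False using \<omega> by auto
    qed
    ultimately show "\<omega> \<in> (\<Union>a\<in>I. F a)" by blast
  qed
  then have "outer_measure_of M ?F \<le> outer_measure_of M (\<Union>a\<in>I. F a)"
    by (rule outer_measure_of_mono)
  also have "\<dots> \<le> (\<Sum>a\<in>I. outer_measure_of M (F a))"
    using I by (intro outer_measure_of_finite_UN_le) (auto simp: F_def)
  also have "\<dots> \<le> (\<Sum>a\<in>I. ennreal (exp (- (q1 * q2 * lam * l ^ DIM('v) * (1 - 1 / 2)))))"
  proof (rule sum_mono)
    fix a :: "'v \<Rightarrow> int"
    have *: "star_region r y \<inter> grid_cell l a \<times> {1 / 2<..<1} = {}" if "2 \<le> y" for r y
    proof -
      have "1 / y \<le> 1 / 2" using that by (intro divide_left_mono) auto
      then show ?thesis by (auto simp: star_region_def)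
    qed
    show "outer_measure_of M (F a) \<le> ennreal (exp (- (q1 * q2 * lam * l ^ DIM('v) * (1 - 1 / 2))))"
      unfolding F_def S1_def S2_def
      using k q l z by (intro outer_measure_no_link * star_region_borel emeasure_grid_cell) (auto simp: grid_cell_def)
  qed
  also have "\<dots> = ennreal (real (card I) * exp (- (q1 * q2 * lam * l ^ DIM('v) / 2)))"
    by (simp add: ennreal_mult' ennreal_of_nat_eq_real_of_nat)
  finally show ?thesis unfolding I(2) .
qed

lemma outer_measure_no_star:
  assumes "0 < k" "1 \<le> z" "0 \<le> R"
  shows "outer_measure_of M {\<omega> \<in> space M. \<not> occupied (real k) (star_region R z) \<omega>}
    \<le> ennreal (exp (- (lam * (2 * R) ^ DIM('v) / z)))"
  using outer_measure_not_occupied [OF assms(1) cube_borel emeasure_cube [OF assms(3)], of 0 "1 / z"] assms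
  by (simp add: star_region_def)

text \<open>An empty next scale does not spoil this level, since it already counts as a failure of
  the next one. Two scales occur, so \<open>R\<close> is passed as a function.\<close>

definition good_level :: "nat \<Rightarrow> real \<Rightarrow> (real \<Rightarrow> real) \<Rightarrow> real \<Rightarrow> real \<Rightarrow> real \<Rightarrow> 'w \<Rightarrow> bool" where
  "good_level k z R l q1 q2 \<omega> \<longleftrightarrow> occupied k (star_region (R z) z) \<omega> \<and>
    (occupied k (star_region (R (2 * z)) (2 * z)) \<omega> \<longrightarrow>
      first_in k (star_region (R z) z) \<omega> = first_in k (star_region (R (2 * z)) (2 * z)) \<omega> \<or>
      linked k l q1 q2 \<omega> (first_in k (star_region (R z) z) \<omega>) (first_in k (star_region (R (2 * z)) (2 * z)) \<omega>))"

lemma outer_measure_not_good_level: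
  assumes k: "0 < k" and z: "2 \<le> z" and l: "0 < l" "R z \<le> real K * l" "0 \<le> R z"
    and q: "0 \<le> q1" "q1 \<le> 1" "0 \<le> q2" "q2 \<le> 1"
  shows "outer_measure_of M {\<omega> \<in> space M. \<not> good_level k z R l q1 q2 \<omega>}
    \<le> ennreal (exp (- (lam * (2 * R z) ^ DIM('v) / z))
        + (2 * real K) ^ DIM('v) * exp (- (q1 * q2 * lam * l ^ DIM('v) / 2)))"
proof -
  let ?A = "{\<omega> \<in> space M. \<not> occupied (real k) (star_region (R z) z) \<omega>}"
  let ?B = "{\<omega> \<in> space M. occupied k (star_region (R z) z) \<omega> \<and> occupied k (star_region (R (2 * z)) (2 * z)) \<omega> \<and>
      first_in k (star_region (R z) z) \<omega> \<noteq> first_in k (star_region (R (2 * z)) (2 * z)) \<omega> \<and>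
      \<not> linked k l q1 q2 \<omega> (first_in k (star_region (R z) z) \<omega>) (first_in k (star_region (R (2 * z)) (2 * z)) \<omega>)}"
  have "outer_measure_of M {\<omega> \<in> space M. \<not> good_level k z R l q1 q2 \<omega>} \<le> outer_measure_of M (?A \<union> ?B)"
    by (rule outer_measure_of_mono) (auto simp: good_level_def)
  also have "\<dots> \<le> outer_measure_of M ?A + outer_measure_of M ?B"
    by (rule outer_measure_of_Un_le) auto
  also have "\<dots> \<le> ennreal (exp (- (lam * (2 * R z) ^ DIM('v) / z)))
      + ennreal ((2 * real K) ^ DIM('v) * exp (- (q1 * q2 * lam * l ^ DIM('v) / 2)))"
    using assms by (intro add_mono outer_measure_no_star outer_measure_not_linked) auto
  finally show ?thesis by (simp add: ennreal_plus)
qed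

end

section \<open>The tail of the percolation time\<close>

text \<open>Each of the two terms in the failure bound at scale \<open>z\<close> is absorbed into
  half of \<open>exp (- (z powr \<beta>)) / z\<close>. The factor \<open>1 / z\<close> makes the
  scales summable and later cancels the number of times.\<close>

lemma stretched_exp_beats_powr:
  fixes A c b \<beta> p :: real
  assumes "0 < c" "0 < \<beta>" "\<beta> < b"
  shows "\<forall>\<^sub>F z in at_top. A * z powr p * exp (- (c * z powr b)) \<le> exp (- (z powr \<beta>)) / (2 * z)"
proof -
  have "((\<lambda>z::real. z powr (p + 1) * exp (z powr \<beta> - c * z powr b)) \<longlongrightarrow> 0) at_top"
    using assms by real_asymp
  from tendsto_mult_right_zero [OF this, of "2 * A"]
  have "\<forall>\<^sub>F z in at_top. 2 * A * (z powr (p + 1) * exp (z powr \<beta> - c * z powr b)) < 1"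
    by (rule order_tendstoD) simp
  then show ?thesis
    using eventually_gt_at_top [of 0]
  proof eventually_elim
    case (elim z)
    have "A * z powr p * exp (- (c * z powr b)) * (2 * z) * exp (z powr \<beta>)
        = 2 * A * (z powr (p + 1) * exp (z powr \<beta> - c * z powr b))"
      using elim by (simp add: powr_add exp_diff exp_minus field_simps)
    also have "\<dots> \<le> 1" using elim by simp
    finally have "A * z powr p * exp (- (c * z powr b)) * (2 * z) * exp (z powr \<beta>) \<le> 1" .
    then show ?case
      using elim by (simp add: exp_minus field_simps)
  qed
qed

text \<open>The exponent \<open>1 / c\<close> lies strictly below \<open>b\<close> and
  \<open>\<beta>\<close>, which leaves room for all multiplicative constants, including the factor
  \<open>c\<close>.\<close>

lemma sum_of_stretched_exp:
  fixes c1 \<beta> b c :: real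
  assumes "0 < c1" "0 < b" "0 < \<beta>" "1 < c * b" "1 < c * \<beta>" "0 < c"
  shows "\<forall>\<^sub>F t in at_top. exp (- (c1 * t powr b)) + 2 * exp (- (t powr \<beta>)) \<le> exp (- c * t powr (1 / c))"
proof -
  have 1: "1 / c < b" "1 / c < \<beta>" using assms by (auto simp: field_simps)
  define e where "e = 1 / c"
  have e: "0 < e" "e < b" "e < \<beta>" using 1 assms by (auto simp: e_def)
  have "((\<lambda>t::real. exp (c * t powr e - c1 * t powr b)) \<longlongrightarrow> 0) at_top"
    using assms e by real_asymp
  then have A: "\<forall>\<^sub>F t in at_top. exp (c * t powr e - c1 * t powr b) < 1 / 2"
    by (rule order_tendstoD) simp
  have "((\<lambda>t::real. exp (c * t powr e - t powr \<beta>)) \<longlongrightarrow> 0) at_top"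
    using assms e by real_asymp
  then have "\<forall>\<^sub>F t in at_top. exp (c * t powr e - t powr \<beta>) < 1 / 4"
    by (rule order_tendstoD) simp
  with A show ?thesis
  proof eventually_elim
    case (elim t)
    have "(exp (- (c1 * t powr b)) + 2 * exp (- (t powr \<beta>))) * exp (c * t powr e)
        = exp (c * t powr e - c1 * t powr b) + 2 * exp (c * t powr e - t powr \<beta>)"
      by (simp add: exp_diff exp_minus field_simps)
    also have "\<dots> \<le> 1" using elim by simp
    finally show ?case by (simp add: e_def exp_minus field_simps)
  qed
qed

context mobile_graph
begin

text \<open>A deterministic inclusion. If all levels are good at the integer times up to
  \<open>t\<close> and at one of them the origin vertex is joined to the first star of scale
  \<open>t\<close>, then the chain of stars at that time bounds the percolation time. The mark of
  the origin vertex must lie in the unit interval for \<open>far\<close> to apply to it.\<close>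

lemma percolation_time_gt_subset:
  fixes p :: "'v \<times> real \<Rightarrow> 'v \<times> real \<Rightarrow> real" and q R l :: "real \<Rightarrow> real"
  assumes t: "2 \<le> t"
    and near: "\<And>x y z. x \<in> vertex_space \<Longrightarrow> y \<in> vertex_space \<Longrightarrow> 2 \<le> z \<Longrightarrow>
      min (snd x) (snd y) \<le> 1 / z \<Longrightarrow> norm (fst x - fst y) \<le> real DIM('v) * l z \<Longrightarrow> q1 \<le> p x y"
    and far: "\<And>x y z. x \<in> vertex_space \<Longrightarrow> y \<in> vertex_space \<Longrightarrow> 2 \<le> z \<Longrightarrow>
      min (snd x) (snd y) \<le> 1 / z \<Longrightarrow> norm (fst x - fst y) \<le> 3 * real DIM('v) * R z \<Longrightarrow> q z \<le> p x y"
    and R: "\<And>z. 2 \<le> z \<Longrightarrow> 0 \<le> R z" "\<And>z. 2 \<le> z \<Longrightarrow> R z \<le> R (2 * z)" "\<And>z. 2 \<le> z \<Longrightarrow> l z \<le> R z"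
  shows "{\<omega> \<in> space M. percolation_time p U0 P B E \<omega> > ereal t}
    \<subseteq> {\<omega> \<in> space M. U0 \<omega> \<notin> {0<..<1}}
      \<union> ((\<Union>k\<in>{1..nat \<lfloor>t\<rfloor>}. \<Union>n. {\<omega> \<in> space M. \<not> good_level k (t * 2 ^ n) R (l (t * 2 ^ n)) q1 (q (2 * (t * 2 ^ n))) \<omega>})
      \<union> {\<omega> \<in> space M. \<forall>k\<in>{1..nat \<lfloor>t\<rfloor>}. occupied (real k) (star_region (R t) t) \<omega> \<and>
            \<not> edge k 0 (Suc (first_in (real k) (star_region (R t) t) \<omega>)) \<omega> < q t})"
proof (rule subsetI, rule ccontr)
  fix \<omega>
  assume "\<omega> \<in> {\<omega> \<in> space M. percolation_time p U0 P B E \<omega> > ereal t}"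
  then have \<omega>: "\<omega> \<in> space M" "percolation_time p U0 P B E \<omega> > ereal t" by auto
  define S where "S z = (star_region (R z) z :: ('v \<times> real) set)" for z
  define zs where "zs n = t * 2 ^ n" for n :: nat
  have zs: "2 \<le> zs n" "zs (Suc n) = 2 * zs n" "zs 0 = t" for n
    using t mult_mono [of 2 t 1 "2 ^ n :: real"] by (auto simp: zs_def)
  assume "\<omega> \<notin> {\<omega> \<in> space M. U0 \<omega> \<notin> {0<..<1}}
      \<union> ((\<Union>k\<in>{1..nat \<lfloor>t\<rfloor>}. \<Union>n. {\<omega> \<in> space M. \<not> good_level k (t * 2 ^ n) R (l (t * 2 ^ n)) q1 (q (2 * (t * 2 ^ n))) \<omega>})
      \<union> {\<omega> \<in> space M. \<forall>k\<in>{1..nat \<lfloor>t\<rfloor>}. occupied (real k) (star_region (R t) t) \<omega> \<and>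
            \<not> edge k 0 (Suc (first_in (real k) (star_region (R t) t) \<omega>)) \<omega> < q t})"
  then have U: "U0 \<omega> \<in> {0<..<1}"
    and good': "\<And>k n. k \<in> {1..nat \<lfloor>t\<rfloor>} \<Longrightarrow> good_level k (zs n) R (l (zs n)) q1 (q (2 * zs n)) \<omega>"
    and "\<exists>k\<in>{1..nat \<lfloor>t\<rfloor>}. \<not> (occupied (real k) (S t) \<omega> \<and> \<not> edge k 0 (Suc (first_in (real k) (S t) \<omega>)) \<omega> < q t)"
    using \<omega> by (auto simp: zs_def S_def)
  \<comment> \<open>Outside the last event, at some time \<open>k\<close> the star is missing or the
    edge is present. Good levels exclude the former.\<close>
  then obtain k where k: "k \<in> {1..nat \<lfloor>t\<rfloor>}"
    and e0: "occupied (real k) (S t) \<omega> \<Longrightarrow> edge k 0 (Suc (first_in (real k) (S t) \<omega>)) \<omega> < q t" by blast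
  note good = good' [OF k]
  define J where "J n = first_in (real k) (S (zs n)) \<omega>" for n
  have occ: "occupied (real k) (S (zs n)) \<omega>" for n
    using good [of n] by (auto simp: good_level_def S_def)
  have J: "fst (relative_vertex k \<omega> (J n)) \<in> cube (R (zs n))" "snd (relative_vertex k \<omega> (J n)) < 1 / zs n" for n
    using rel_first_in [OF occ, of n] by (auto simp: J_def S_def star_region_def mem_Times_iff)
  have nJ: "norm (fst (relative_vertex k \<omega> (J n))) \<le> real DIM('v) * R (zs n)" for n
    using J(1) [of n] by (intro norm_le_DIM) (auto simp: mem_cube intro: less_imp_le)
  define v where "v = vertex_at U0 P B (real k) \<omega>"
  have vS: "v (Suc i) \<in> vertex_space" for i unfolding v_def by (rule vertex_at_in_vertex_space [OF \<omega>(1)])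
  have v0: "v 0 \<in> vertex_space" using U by (simp add: v_def vertex_at_0 vertex_space_def)
  have vJ: "snd (v (Suc (J n))) \<le> 1 / zs n" for n
    using J(2) [of n] by (simp add: v_def vertex_at_relative_vertex)
  have "percolation_time p U0 P B E \<omega> \<le> ereal (real k)"
  proof (rule percolation_time_le [OF \<omega>(1)])
    show "snd (P (J n) \<omega>) < 1 / zs n" for n
      using J(2) [of n] by (simp add: snd_relative_vertex)
    show "(\<lambda>n. 1 / zs n) \<longlonglongrightarrow> 0"
      unfolding zs_def using t by real_asymp
    show "mobile_adjacent p U0 P B E (real k) \<omega> (Suc (J 0)) 0"
    proof -
      have "norm (fst (v (Suc (J 0))) - fst (v 0)) = norm (fst (relative_vertex k \<omega> (J 0)))"
        by (simp add: v_def vertex_at_relative_vertex vertex_at_0)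
      also have "\<dots> \<le> 3 * real DIM('v) * R t"
      proof -
        have "0 \<le> real DIM('v) * R t" using R(1) [OF t] by simp
        then show ?thesis using nJ [of 0] by (simp add: zs(3))
      qed
      finally have "q t \<le> p (v (Suc (J 0))) (v 0)"
        using vJ [of 0] t by (intro far vS v0) (auto simp: zs(3))
      moreover have "edge k (Suc (J 0)) 0 \<omega> < q t"
        using e0 occ [of 0] by (simp add: J_def zs(3) edge_def)
      ultimately show ?thesis
        unfolding mobile_adjacent_iff v_def by simp
    qed
    show "J n = J (Suc n) \<or> (\<exists>w. mobile_adjacent p U0 P B E (real k) \<omega> (Suc (J n)) w
        \<and> mobile_adjacent p U0 P B E (real k) \<omega> w (Suc (J (Suc n))))" for n
    proof (cases "J n = J (Suc n)")
      case False
      then have "linked k (l (zs n)) q1 (q (2 * zs n)) \<omega> (J n) (J (Suc n))"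
        using good [of n] occ [of "Suc n"] by (auto simp: good_level_def J_def S_def zs(2))
      then obtain w where w: "norm (fst (relative_vertex k \<omega> w) - fst (relative_vertex k \<omega> (J n))) \<le> real DIM('v) * l (zs n)"
          "1 / 2 < snd (relative_vertex k \<omega> w)" "edge k (Suc (J n)) (Suc w) \<omega> < q1"
          "edge k (Suc w) (Suc (J (Suc n))) \<omega> < q (zs (Suc n))"
        unfolding linked_def zs(2) by blast
      have half: "1 / zs m \<le> 1 / 2" for m using zs(1) [of m] by (simp add: field_simps)
      have wJ: "w \<noteq> J m" for m
        using w(2) J(2) [of m] half [of m] by auto
      have "q1 \<le> p (v (Suc (J n))) (v (Suc w))"
      proof (rule near [OF vS vS zs(1)])
        show "min (snd (v (Suc (J n)))) (snd (v (Suc w))) \<le> 1 / zs n" using vJ [of n] by simp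
        show "norm (fst (v (Suc (J n))) - fst (v (Suc w))) \<le> real DIM('v) * l (zs n)"
          using w(1) by (simp add: v_def vertex_at_relative_vertex norm_minus_commute)
      qed
      moreover have "q (zs (Suc n)) \<le> p (v (Suc w)) (v (Suc (J (Suc n))))"
      proof (rule far [OF vS vS zs(1)])
        show "min (snd (v (Suc w))) (snd (v (Suc (J (Suc n))))) \<le> 1 / zs (Suc n)" using vJ [of "Suc n"] by simp
        let ?d = "real DIM('v)"
        \<comment> \<open>The way from the connector leads to the old star, then to the origin
          vertex, then to the new star. Each of these three distances is at most
          \<open>?d * R (zs (Suc n))\<close>, whence the factor 3 in \<open>far\<close>.\<close>
        have "norm (fst (v (Suc w)) - fst (v (Suc (J (Suc n)))))
          = norm ((fst (relative_vertex k \<omega> w) - fst (relative_vertex k \<omega> (J n))) + (fst (relative_vertex k \<omega> (J n)) - fst (relative_vertex k \<omega> (J (Suc n)))))"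
          by (simp add: v_def vertex_at_relative_vertex)
        also have "\<dots> \<le> norm (fst (relative_vertex k \<omega> w) - fst (relative_vertex k \<omega> (J n))) + (norm (fst (relative_vertex k \<omega> (J n))) + norm (fst (relative_vertex k \<omega> (J (Suc n)))))"
          by (intro order_trans [OF norm_triangle_ineq] add_left_mono norm_triangle_ineq4)
        also have "\<dots> \<le> ?d * l (zs n) + (?d * R (zs n) + ?d * R (zs (Suc n)))"
          by (intro add_mono w nJ)
        also have "\<dots> \<le> ?d * R (zs (Suc n)) + (?d * R (zs (Suc n)) + ?d * R (zs (Suc n)))"
          using R(2,3) [OF zs(1) [of n]] by (intro add_mono mult_left_mono order_refl) (auto simp: zs(2))
        finally show "norm (fst (v (Suc w)) - fst (v (Suc (J (Suc n))))) \<le> 3 * ?d * R (zs (Suc n))"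
          by simp
      qed
      ultimately show ?thesis
        using w wJ [of n] wJ [of "Suc n"] unfolding mobile_adjacent_iff v_def
        by (intro disjI2 exI [of _ "Suc w"]) auto
    qed simp
  qed
  also have "real k \<le> t" using k t by (auto simp: le_nat_iff le_floor_iff)
  finally show False using \<omega>(2) by simp
qed

lemma origin_mark_null: "outer_measure_of M {\<omega> \<in> space M. U0 \<omega> \<notin> {0<..<1}} = 0"
proof -
  have [measurable]: "U0 \<in> measurable M borel" and d: "distr M borel U0 = uniform_measure lborel {0<..<1}"
    using origin_mark_uniform by (auto simp: uniform01_def)
  have "emeasure M {\<omega> \<in> space M. U0 \<omega> \<notin> {0<..<1}} = emeasure (distr M borel U0) (- {0<..<1})"
    by (subst emeasure_distr) (auto intro!: arg_cong [where f="emeasure M"])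
  also have "\<dots> = 0" unfolding d by (subst emeasure_uniform_measure) auto
  finally have "emeasure M {\<omega> \<in> space M. U0 \<omega> \<notin> {0<..<1}} = 0" .
  moreover have "{\<omega> \<in> space M. U0 \<omega> \<notin> {0<..<1}} \<in> sets M" by measurable
  ultimately show ?thesis using outer_measure_of_eq by metis
qed

text \<open>A union bound over the integer times up to \<open>t\<close> and the scales
  \<open>t * 2 ^ n\<close>. The factor \<open>1 / z\<close> is geometric over the scales, so the
  failures at one time sum to at most \<open>2 / t * exp (- (t powr \<beta>))\<close>, and the at
  most \<open>t\<close> times cancel the \<open>1 / t\<close>.\<close>

lemma percolation_tail:
  fixes p :: "'v \<times> real \<Rightarrow> 'v \<times> real \<Rightarrow> real" and q R l :: "real \<Rightarrow> real" and K :: "real \<Rightarrow> nat"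
  assumes t: "2 \<le> t" and "0 \<le> \<beta>"
    and near: "\<And>x y z. x \<in> vertex_space \<Longrightarrow> y \<in> vertex_space \<Longrightarrow> 2 \<le> z \<Longrightarrow>
      min (snd x) (snd y) \<le> 1 / z \<Longrightarrow> norm (fst x - fst y) \<le> real DIM('v) * l z \<Longrightarrow> q1 \<le> p x y"
    and far: "\<And>x y z. x \<in> vertex_space \<Longrightarrow> y \<in> vertex_space \<Longrightarrow> 2 \<le> z \<Longrightarrow>
      min (snd x) (snd y) \<le> 1 / z \<Longrightarrow> norm (fst x - fst y) \<le> 3 * real DIM('v) * R z \<Longrightarrow> q z \<le> p x y"
    and R: "\<And>z. 2 \<le> z \<Longrightarrow> R z \<le> R (2 * z)" "\<And>z. 2 \<le> z \<Longrightarrow> l z \<le> R z"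
    and l: "\<And>z. 2 \<le> z \<Longrightarrow> 0 < l z" "\<And>z. 2 \<le> z \<Longrightarrow> R z \<le> real (K z) * l z"
    and q: "0 \<le> q1" "q1 \<le> 1" "\<And>z. 2 \<le> z \<Longrightarrow> 0 \<le> q z" "\<And>z. 2 \<le> z \<Longrightarrow> q z \<le> 1"
    and bound: "\<And>z. t \<le> z \<Longrightarrow> exp (- (lam * (2 * R z) ^ DIM('v) / z))
        + (2 * real (K z)) ^ DIM('v) * exp (- (q1 * q (2 * z) * lam * l z ^ DIM('v) / 2)) \<le> exp (- (z powr \<beta>)) / z"
  shows "outer_measure_of M {\<omega> \<in> space M. percolation_time p U0 P B E \<omega> > ereal t}
    \<le> ennreal ((1 - q t) ^ nat \<lfloor>t\<rfloor> + 2 * exp (- (t powr \<beta>)))"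
proof -
  define N where "N = nat \<lfloor>t\<rfloor>"
  define Bad where "Bad k n = {\<omega> \<in> space M. \<not> good_level k (t * 2 ^ n) R (l (t * 2 ^ n)) q1 (q (2 * (t * 2 ^ n))) \<omega>}" for k n
  have R0: "0 \<le> R z" if "2 \<le> z" for z using R(2) [OF that] l(1) [OF that] by simp
  have "outer_measure_of M {\<omega> \<in> space M. percolation_time p U0 P B E \<omega> > ereal t}
    \<le> outer_measure_of M ({\<omega> \<in> space M. U0 \<omega> \<notin> {0<..<1}} \<union> ((\<Union>k\<in>{1..N}. \<Union>n. Bad k n)
      \<union> {\<omega> \<in> space M. \<forall>k\<in>{1..N}. occupied (real k) (star_region (R t) t) \<omega> \<and>
            \<not> edge k 0 (Suc (first_in (real k) (star_region (R t) t) \<omega>)) \<omega> < q t}))"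
    unfolding N_def Bad_def
    by (intro outer_measure_of_mono percolation_time_gt_subset t R R0) (use near far in blast)+
  also have "\<dots> \<le> 0 + ((\<Sum>k\<in>{1..N}. ennreal (2 / t * exp (- (t powr \<beta>)))) + ennreal ((1 - q t) ^ N))"
  proof (intro order_trans [OF outer_measure_of_Un_le] add_mono)
    show "outer_measure_of M {\<omega> \<in> space M. U0 \<omega> \<notin> {0<..<1}} \<le> 0" by (rule eq_refl [OF origin_mark_null])
    show "outer_measure_of M {\<omega> \<in> space M. \<forall>k\<in>{1..N}. occupied (real k) (star_region (R t) t) \<omega> \<and>
            \<not> edge k 0 (Suc (first_in (real k) (star_region (R t) t) \<omega>)) \<omega> < q t} \<le> ennreal ((1 - q t) ^ N)"
      using t q by (intro outer_measure_origin_never_linked star_region_borel) auto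
    have "outer_measure_of M (\<Union>k\<in>{1..N}. \<Union>n. Bad k n) \<le> (\<Sum>k\<in>{1..N}. outer_measure_of M (\<Union>n. Bad k n))"
      by (intro outer_measure_of_finite_UN_le) (auto simp: Bad_def)
    also have "\<dots> \<le> (\<Sum>k\<in>{1..N}. ennreal (2 / t * exp (- (t powr \<beta>))))"
    proof (rule sum_mono)
      fix k assume k: "k \<in> {1..N}"
      have "outer_measure_of M (\<Union>n. Bad k n) \<le> (\<Sum>n. outer_measure_of M (Bad k n))"
        by (intro outer_measure_of_UN_le) (auto simp: Bad_def)
      also have "\<dots> \<le> (\<Sum>n. ennreal ((1 / 2) ^ n * (exp (- (t powr \<beta>)) / t)))"
      proof (intro suminf_le summableI)
        fix n
        define z where "z = t * 2 ^ n"
        have z: "t \<le> z" using t by (simp add: z_def)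
        then have z2: "2 \<le> z" using t by simp
        have "outer_measure_of M (Bad k n) \<le> ennreal (exp (- (lam * (2 * R z) ^ DIM('v) / z))
          + (2 * real (K z)) ^ DIM('v) * exp (- (q1 * q (2 * z) * lam * l z ^ DIM('v) / 2)))"
          unfolding Bad_def z_def [symmetric] using k z2 R0 l q by (intro outer_measure_not_good_level) auto
        also have "\<dots> \<le> ennreal (exp (- (z powr \<beta>)) / z)"
          by (intro ennreal_leI bound z)
        also have "\<dots> \<le> ennreal (exp (- (t powr \<beta>)) / z)"
          using z t \<open>0 \<le> \<beta>\<close> by (intro ennreal_leI divide_right_mono) (auto intro: powr_mono2)
        also have "exp (- (t powr \<beta>)) / z = (1 / 2) ^ n * (exp (- (t powr \<beta>)) / t)"
          by (simp add: z_def power_one_over field_simps)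
        finally show "outer_measure_of M (Bad k n) \<le> ennreal ((1 / 2) ^ n * (exp (- (t powr \<beta>)) / t))" .
      qed
      also have "\<dots> = ennreal (2 * (exp (- (t powr \<beta>)) / t))"
        using t power_half_series
        by (intro suminf_ennreal_eq sums_mult2) (auto intro: geometric_sums [of "1 / 2 :: real", simplified])
      finally show "outer_measure_of M (\<Union>n. Bad k n) \<le> ennreal (2 / t * exp (- (t powr \<beta>)))" by simp
    qed
    finally show "outer_measure_of M (\<Union>k\<in>{1..N}. \<Union>n. Bad k n) \<le> (\<Sum>k\<in>{1..N}. ennreal (2 / t * exp (- (t powr \<beta>))))" .
  qed (auto simp: Bad_def)
  also have "\<dots> = ennreal (real N * (2 / t * exp (- (t powr \<beta>))) + (1 - q t) ^ N)"
    using t q by (simp add: ennreal_of_nat_eq_real_of_nat ennreal_mult' [symmetric] ennreal_plus)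
  also have "\<dots> \<le> ennreal ((1 - q t) ^ N + 2 * exp (- (t powr \<beta>)))"
  proof (rule ennreal_leI)
    have "real N \<le> t" using t by (simp add: N_def)
    then have "real N * (2 / t * exp (- (t powr \<beta>))) \<le> t * (2 / t * exp (- (t powr \<beta>)))"
      using t by (intro mult_right_mono) auto
    then show "real N * (2 / t * exp (- (t powr \<beta>))) + (1 - q t) ^ N \<le> (1 - q t) ^ N + 2 * exp (- (t powr \<beta>))"
      using t by simp
  qed
  finally show ?thesis by (simp add: N_def)
qed

end

section \<open>Choice of the exponents and the tail bound\<close>

lemma powr_divide_power:
  assumes "0 < n" "0 < (z::real)"
  shows "(z powr (a / real n)) ^ n = z powr a"
proof -
  have "(z powr (a / real n)) ^ n = (z powr (a / real n)) powr real n"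
    using assms by (simp add: powr_realpow)
  then show ?thesis using assms by (simp add: powr_powr)
qed

theorem theorem2:
  fixes p :: "'v::euclidean_space \<times> real \<Rightarrow> 'v \<times> real \<Rightarrow> real"
    and \<alpha> \<kappa> \<gamma> \<delta> :: real
  assumes "\<delta> > 1" and "0 < \<gamma>" and "\<gamma> < 1" and "\<gamma> > \<delta> / (\<delta> + 1)"
    and p_measurable:
      "case_prod p \<in> borel_measurable (restrict_space borel (vertex_space \<times> vertex_space))"
    and p_probability: "\<And>x y. x \<in> vertex_space \<Longrightarrow> y \<in> vertex_space \<Longrightarrow> 0 \<le> p x y \<and> p x y \<le> 1"
    and p_symmetric: "\<And>x y. x \<in> vertex_space \<Longrightarrow> y \<in> vertex_space \<Longrightarrow> p x y = p y x"
    and "\<alpha> > 0" and "\<kappa> > 0"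
    and p_lower_bound: "\<And>x y. x \<in> vertex_space \<Longrightarrow> y \<in> vertex_space \<Longrightarrow>
           p x y \<ge> connection_lower_bound \<alpha> \<kappa> \<gamma> \<delta> x y"
    and finite_expected_degree: "\<And>(M :: 'w measure) lam P W x.
           static_graph M lam P W \<Longrightarrow> x \<in> vertex_space \<Longrightarrow> expected_degree M p P W x < \<infinity>"
  shows "\<exists>c>0. \<forall>lam>0. \<forall>\<^sub>F t in at_top. \<forall>(M :: 'w measure) U0 P B E.
           mobile_graph M lam U0 P B E \<longrightarrow>
             outer_measure_of M {\<omega> \<in> space M. percolation_time p U0 P B E \<omega> > ereal t}
               \<le> ennreal (exp (- c * t powr (1 / c)))"
proof -
  define d where "d = real DIM('v)"
  have d: "1 \<le> d" unfolding d_def using DIM_positive [where 'a='v] by linarith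
  \<comment> \<open>With this \<open>\<eta>\<close> the exponent \<open>e\<close> is the midpoint
    between \<open>\<delta> * (1 - \<gamma>)\<close> and \<open>\<gamma>\<close>, an interval that
    is nonempty by \<open>gap\<close>.\<close>
  define \<eta> where "\<eta> = (\<gamma> - \<delta> * (1 - \<gamma>)) / (2 * \<delta>)"
  define e where "e = \<delta> * (1 + \<eta> - \<gamma>)"
  have gap: "\<delta> * (1 - \<gamma>) < \<gamma>"
    using assms(1,4) by (simp add: field_simps)
  have \<eta>: "0 < \<eta>" using gap assms(1) by (simp add: \<eta>_def)
  have "e = (\<gamma> + \<delta> * (1 - \<gamma>)) / 2"
    using assms(1) by (simp add: e_def \<eta>_def field_simps)
  moreover have "0 < \<delta> * (1 - \<gamma>)" using \<open>\<gamma> < 1\<close> assms(1) by simp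
  moreover have "0 < e \<and> e < \<gamma>" if "0 < g" "g < \<gamma>" "e = (\<gamma> + g) / 2" for g
    using that by simp
  ultimately have e: "0 < e" "e < \<gamma>" using gap by blast+
  \<comment> \<open>The cube of volume of order \<open>z powr (1 + \<eta>)\<close> contains of order
    \<open>z powr \<eta>\<close> stars on average, and a cell of side \<open>l z\<close> of order
    \<open>z powr \<gamma>\<close> connectors. Up to distances of order \<open>l z\<close> a star of
    scale \<open>z\<close> connects with probability of order one.\<close>
  define R where "R z = z powr ((1 + \<eta>) / d)" for z
  define l where "l z = z powr (\<gamma> / d)" for z
  define K where "K z = nat \<lceil>R z / l z\<rceil>" for z
  \<comment> \<open>The constants \<open>d\<close> and \<open>3 * d\<close> in \<open>q1\<close> and
    \<open>c2\<close> are the factors of \<open>l z\<close> and \<open>R z\<close> in the distance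
    bounds of \<open>near\<close> and \<open>far\<close>.\<close>
  define q1 where "q1 = \<alpha> * min 1 (\<kappa> * d powr (- (\<delta> * d)))"
  define c2 where "c2 = \<alpha> * min 1 (\<kappa> * (3 * d) powr (- (\<delta> * d)))"
  define q where "q z = c2 * z powr (- e)" for z
  \<comment> \<open>At equal locations the lower bound is \<open>\<alpha>\<close> itself, while
    \<open>p\<close> is at most 1.\<close>
  have "\<alpha> \<le> 1"
  proof -
    have v: "(0, 1 / 2) \<in> (vertex_space :: ('v \<times> real) set)" by (simp add: vertex_space_def)
    then show ?thesis
      using p_lower_bound [OF v v] p_probability [OF v v] by (simp add: connection_lower_bound_def)
  qed
  then have q1: "0 < q1" "q1 \<le> 1" and c2: "0 < c2" "c2 \<le> 1"
    using \<open>\<alpha> > 0\<close> \<open>\<kappa> > 0\<close> d by (auto simp: q1_def c2_def intro!: mult_le_one)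
  have q: "0 < q z" "q z \<le> 1" if "2 \<le> z" for z
  proof -
    have "z powr (- e) \<le> 1" using that e powr_mono [of "- e" 0 z] by simp
    then show "0 < q z" "q z \<le> 1" using c2 that by (auto simp: q_def intro: mult_le_one)
  qed
  have lR: "1 \<le> l z" "l z \<le> R z" "R z \<le> real (K z) * l z" "real (K z) \<le> 2 * R z" "R z \<le> R (2 * z)"
    if "2 \<le> z" for z
  proof -
    show l1: "1 \<le> l z" using that d \<open>0 < \<gamma>\<close> powr_mono [of 0 "\<gamma> / d" z] by (simp add: l_def)
    show lR: "l z \<le> R z" unfolding l_def R_def
      using that d \<open>\<gamma> < 1\<close> \<eta> by (intro powr_mono divide_right_mono) auto
    have Rl: "R z / l z \<le> real (K z)" unfolding K_def by linarith
    then show "R z \<le> real (K z) * l z" using l1 by (simp add: field_simps)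
    have "0 \<le> R z / l z" using l1 lR by simp
    then have "real (K z) \<le> R z / l z + 1" unfolding K_def by linarith
    also have "R z / l z \<le> R z / 1" using l1 lR by (intro divide_left_mono) auto
    finally show "real (K z) \<le> 2 * R z" using l1 lR by simp
    show "R z \<le> R (2 * z)" unfolding R_def using that d \<eta> by (intro powr_mono2) auto
  qed
  have near: "q1 \<le> p x y" if "x \<in> vertex_space" "y \<in> vertex_space" "2 \<le> z"
      "min (snd x) (snd y) \<le> 1 / z" "norm (fst x - fst y) \<le> real DIM('v) * l z" for x y z
    using connection_lower_bound_ge [of x y z d \<gamma> \<gamma> \<alpha> \<kappa> \<delta>] p_lower_bound [of x y] that d assms(1,2) \<open>\<alpha> > 0\<close> \<open>\<kappa> > 0\<close>
    by (simp add: q1_def d_def l_def)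
  have far: "q z \<le> p x y" if "x \<in> vertex_space" "y \<in> vertex_space" "2 \<le> z"
      "min (snd x) (snd y) \<le> 1 / z" "norm (fst x - fst y) \<le> 3 * real DIM('v) * R z" for x y z
    using connection_lower_bound_ge [of x y z "3 * d" "1 + \<eta>" \<gamma> \<alpha> \<kappa> \<delta>] p_lower_bound [of x y] that d assms(1,2,3) \<eta> \<open>\<alpha> > 0\<close> \<open>\<kappa> > 0\<close>
    by (simp add: q_def c2_def d_def R_def e_def)
  \<comment> \<open>Strictly below both exponents: \<open>\<eta>\<close> for a missing star and
    \<open>\<gamma> - e\<close> for a missing link.\<close>
  define \<beta> where "\<beta> = min \<eta> (\<gamma> - e) / 2"
  have \<beta>: "0 < \<beta>" "\<beta> < \<eta>" "\<beta> < \<gamma> - e" using \<eta> e by (auto simp: \<beta>_def)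
  \<comment> \<open>\<open>1 / c\<close> is half the smaller of \<open>\<beta>\<close> and
    \<open>1 - e\<close>, hence strictly below both. Neither involves \<open>lam\<close>, so one
    \<open>c\<close> serves all intensities and \<open>lam\<close> affects only how large
    \<open>t\<close> has to be.\<close>
  define c where "c = 2 / min \<beta> (1 - e)"
  have b: "0 < min \<beta> (1 - e)" using \<beta> e \<open>\<gamma> < 1\<close> by simp
  then have c: "0 < c" "1 < c * \<beta>" "1 < c * (1 - e)"
    by (auto simp: c_def field_simps min_def)
  have "\<forall>\<^sub>F t in at_top. \<forall>(M :: 'w measure) U0 P B E.
           mobile_graph M lam U0 P B E \<longrightarrow>
             outer_measure_of M {\<omega> \<in> space M. percolation_time p U0 P B E \<omega> > ereal t}
               \<le> ennreal (exp (- c * t powr (1 / c)))" if lam: "lam > 0" for lam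
  proof -
    \<comment> \<open>Collects the constants of the link term. The factor
      \<open>2 powr (- e)\<close> arises because the connector has to reach a star of scale
      \<open>2 * z\<close>.\<close>
    define c3 where "c3 = lam * q1 * c2 * 2 powr (- e) / 2"
    have c3: "0 < c3" using lam q1 c2 by (simp add: c3_def)
    have level: "exp (- (lam * (2 * R z) ^ DIM('v) / z))
        + (2 * real (K z)) ^ DIM('v) * exp (- (q1 * q (2 * z) * lam * l z ^ DIM('v) / 2))
      \<le> 1 * z powr 0 * exp (- (lam * z powr \<eta>)) + 4 ^ DIM('v) * z powr (1 + \<eta>) * exp (- (c3 * z powr (\<gamma> - e)))"
      if z: "2 \<le> z" for z
    proof (rule add_mono)
      have Rd: "R z ^ DIM('v) = z powr (1 + \<eta>)"
        unfolding R_def d_def using z by (intro powr_divide_power) auto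
      have ld: "l z ^ DIM('v) = z powr \<gamma>"
        unfolding l_def d_def using z by (intro powr_divide_power) auto
      have "z powr \<eta> = 1 * R z ^ DIM('v) / z"
        using z by (simp add: Rd powr_add)
      also have "\<dots> \<le> 2 ^ DIM('v) * R z ^ DIM('v) / z"
        using z lR(1,2) [OF z] by (intro divide_right_mono mult_right_mono) auto
      finally have "lam * z powr \<eta> \<le> lam * ((2 * R z) ^ DIM('v) / z)"
        using lam by (intro mult_left_mono) (auto simp: power_mult_distrib)
      then show "exp (- (lam * (2 * R z) ^ DIM('v) / z)) \<le> 1 * z powr 0 * exp (- (lam * z powr \<eta>))"
        using z by simp
      \<comment> \<open>The number of cells grows only polynomially in \<open>z\<close>, as
        \<open>real (K z) \<le> 2 * R z\<close>.\<close>
      have "(2 * real (K z)) ^ DIM('v) \<le> (4 * R z) ^ DIM('v)"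
        using lR(4) [OF z] by (intro power_mono) auto
      also have "\<dots> = 4 ^ DIM('v) * z powr (1 + \<eta>)" by (simp add: power_mult_distrib Rd)
      finally have 1: "(2 * real (K z)) ^ DIM('v) \<le> 4 ^ DIM('v) * z powr (1 + \<eta>)" .
      have "q1 * q (2 * z) * lam * l z ^ DIM('v) / 2 = c3 * (z powr (- e) * z powr \<gamma>)"
        using z by (simp add: ld q_def c3_def powr_mult)
      also have "z powr (- e) * z powr \<gamma> = z powr (\<gamma> - e)"
        by (simp add: powr_add [symmetric])
      finally show "(2 * real (K z)) ^ DIM('v) * exp (- (q1 * q (2 * z) * lam * l z ^ DIM('v) / 2))
        \<le> 4 ^ DIM('v) * z powr (1 + \<eta>) * exp (- (c3 * z powr (\<gamma> - e)))"
        using 1 by (simp add: mult_right_mono)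
    qed
    have "\<forall>\<^sub>F z in at_top. exp (- (lam * (2 * R z) ^ DIM('v) / z))
        + (2 * real (K z)) ^ DIM('v) * exp (- (q1 * q (2 * z) * lam * l z ^ DIM('v) / 2)) \<le> exp (- (z powr \<beta>)) / z"
      using stretched_exp_beats_powr [OF lam \<beta>(1,2), of 1 0]
        stretched_exp_beats_powr [OF c3 \<beta>(1,3), of "4 ^ DIM('v)" "1 + \<eta>"] eventually_ge_at_top [of 2]
    proof eventually_elim
      case (elim z)
      have "exp (- (z powr \<beta>)) / (2 * z) + exp (- (z powr \<beta>)) / (2 * z) = exp (- (z powr \<beta>)) / z"
        using elim(3) by (simp add: field_simps)
      then show ?case using level [OF elim(3)] elim(1,2) by linarith
    qed
    then obtain z0 where z0: "\<And>z. z0 \<le> z \<Longrightarrow> exp (- (lam * (2 * R z) ^ DIM('v) / z))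
        + (2 * real (K z)) ^ DIM('v) * exp (- (q1 * q (2 * z) * lam * l z ^ DIM('v) / 2)) \<le> exp (- (z powr \<beta>)) / z"
      by (auto simp: eventually_at_top_linorder)
    have "\<forall>\<^sub>F t in at_top. exp (- (c2 / 2 * t powr (1 - e))) + 2 * exp (- (t powr \<beta>)) \<le> exp (- c * t powr (1 / c))"
      using c2 b \<beta>(1) c by (intro sum_of_stretched_exp) auto
    then show ?thesis
      using eventually_ge_at_top [of 2] eventually_ge_at_top [of z0]
    proof eventually_elim
      case (elim t)
      show ?case
      proof (intro allI impI)
        fix M :: "'w measure" and U0 and P :: "nat \<Rightarrow> 'w \<Rightarrow> 'v \<times> real" and B E
        assume "mobile_graph M lam U0 P B E"
        then interpret mobile_graph M lam U0 P B E .
        have "outer_measure_of M {\<omega> \<in> space M. percolation_time p U0 P B E \<omega> > ereal t}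
          \<le> ennreal ((1 - q t) ^ nat \<lfloor>t\<rfloor> + 2 * exp (- (t powr \<beta>)))"
        proof (rule percolation_tail [where R=R and l=l and K=K and ?q1.0=q1])
          show "q1 \<le> p x y" if "x \<in> vertex_space" "y \<in> vertex_space" "2 \<le> z"
            "min (snd x) (snd y) \<le> 1 / z" "norm (fst x - fst y) \<le> real DIM('v) * l z" for x y z
            using that by (rule near)
          show "q z \<le> p x y" if "x \<in> vertex_space" "y \<in> vertex_space" "2 \<le> z"
            "min (snd x) (snd y) \<le> 1 / z" "norm (fst x - fst y) \<le> 3 * real DIM('v) * R z" for x y z
            using that by (rule far)
          show "0 < l z" if "2 \<le> z" for z using lR(1) [OF that] by simp
        qed (use elim(2,3) \<beta>(1) lR q1 q z0 in \<open>auto intro: less_imp_le\<close>)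
        also have "\<dots> \<le> ennreal (exp (- (c2 / 2 * t powr (1 - e))) + 2 * exp (- (t powr \<beta>)))"
        proof (intro ennreal_leI add_right_mono)
          \<comment> \<open>The inequality \<open>1 - x \<le> exp (- x)\<close> and at least
            \<open>t / 2\<close> integer times produce the exponent \<open>1 - e\<close>.\<close>
          have "(1 - q t) ^ nat \<lfloor>t\<rfloor> \<le> exp (- q t) ^ nat \<lfloor>t\<rfloor>"
            using q(2) [OF elim(2)] exp_ge_add_one_self [of "- q t"] by (intro power_mono) auto
          also have "\<dots> = exp (- (q t * real (nat \<lfloor>t\<rfloor>)))"
            by (simp add: exp_of_nat_mult [symmetric] mult.commute)
          also have "\<dots> \<le> exp (- (q t * (t / 2)))"
          proof -
            have "t / 2 \<le> real (nat \<lfloor>t\<rfloor>)" using elim(2) by linarith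
            then show ?thesis using q(1) [OF elim(2)] by simp
          qed
          also have "q t * (t / 2) = c2 / 2 * t powr (1 - e)"
            using elim(2) powr_add [of t 1 "- e"] by (simp add: q_def)
          finally show "(1 - q t) ^ nat \<lfloor>t\<rfloor> \<le> exp (- (c2 / 2 * t powr (1 - e)))" .
        qed
        also have "\<dots> \<le> ennreal (exp (- c * t powr (1 / c)))"
          by (intro ennreal_leI elim(1))
        finally show "outer_measure_of M {\<omega> \<in> space M. percolation_time p U0 P B E \<omega> > ereal t}
          \<le> ennreal (exp (- c * t powr (1 / c)))" .
      qed
    qed
  qed
  with c(1) show ?thesis by blast
qed

end
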